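(* Assume that $\phi_f$ is integrable, let $\mathrm{E}[X^2]<\infty$, and let the kernel $k$ have a Fourier transform $\phi_k$ (with support $[-1,1]$) that is bounded by one and integrates to two. Let $$p_{ng}=\frac g2\int_{-1/g}^{1/g}\frac{\phi_{emp}(t)\,\phi_k(gt)}{e^{-\sigma^2t^2/2}}\,dt .$$ If $g$ is such that $g^{4+4\alpha}e^{\sigma^2/g^2}n^{-1}\to0$, then $p_{ng}$ is a consistent estimator of $p$, i.e. $$\mathrm{P}(|p_{ng}-p|>\epsilon)\to0$$ as $n\to\infty$ and $g\to0$, where $\epsilon$ is an arbitrary positive number. Furthermore, under Conditions F and K (stated in the context), $$\mathrm{E}\bigl[(p_{ng}-p)^2\bigr]=O\!\left(g^{2+2\gamma}+\frac{g^{4+4\alpha}e^{\sigma^2/g^2}}{n}\right).$$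
   Context: Setting: $\sigma>0$ is known and $0\le p<1$. $U,V,Z$ are independent random variables, $U$ is Bernoulli with $\mathrm{P}(U=0)=p$ and $\mathrm{P}(U=1)=1-p$, $V$ has a density $f$ on $\mathbb{R}$ with characteristic function $\phi_f(t)=\int e^{itx}f(x)\,dx$, and $Z$ is standard normal. Put $Y=UV$ and $X=Y+\sigma Z$. The observations $X_1,\dots,X_n$ are i.i.d. copies of $X$, and $\phi_{emp}(t)=\frac1n\sum_{j=1}^n e^{itX_j}$ is the empirical characteristic function. The number $g=g_n>0$ is a bandwidth, and $\phi_k$ denotes the Fourier transform of the kernel $k$. The constants $\alpha\ge0$ and $\gamma>0$ are the exponents appearing in the following two conditions, which are assumed only where the claim invokes them. Condition F: there exists a number $\gamma>0$ such that $|u|^\gamma\phi_f(u)$ is integrable. Condition K: $\phi_k$ is real valued, symmetric, has support $[-1,1]$ and integrates to $2$; moreover, as $t\downarrow0$, $\phi_k(t)=Bt^\gamma+o(t^\gamma)$ and $\phi_k(1-t)=Ct^\alpha+o(t^\alpha)$, where $B$ and $C$ are some constants and $\gamma$ is the same as in Condition F.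
   Formalization: Consistency also assumes φ_k(1−t)=O(t^α) as t↓0 (automatic for α=0), since it fails for φ_k=1 on [−1,1] with α>0; "bounded by one" is relaxed to "bounded", since bound one with integral two contradicts Condition K. *)

theory Defs
  imports "HOL-Probability.Probability" "HOL-Library.Landau_Symbols"
begin

definition fourier :: "(real \<Rightarrow> real) \<Rightarrow> real \<Rightarrow> complex" where
  "fourier f t = (CLBINT x. iexp (t * x) * complex_of_real (f x))"

text \<open>
  A kernel such as the sinc kernel is square integrable but not integrable (its Fourier transform
  jumps at the endpoints of its support), so "\<open>\<phi>\<close> is a Fourier transform of \<open>k\<close>" is meant in the
  sense of Plancherel, with the convention \<open>\<phi>(t) = \<integral> e\<^sup>i\<^sup>t\<^sup>x k(x) dx\<close>.  The function \<open>\<phi>\<close> may be any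
  version of the transform; for \<open>k\<close> both integrable and square integrable, the classical pointwise
  transform is one of them.
\<close>
definition has_fourier_transform :: "(real \<Rightarrow> real) \<Rightarrow> (real \<Rightarrow> complex) \<Rightarrow> bool" where
  "has_fourier_transform k \<phi> \<longleftrightarrow>
     k \<in> borel_measurable borel \<and> \<phi> \<in> borel_measurable borel \<and>
     integrable lborel (\<lambda>x. (k x)\<^sup>2) \<and>
     ((\<lambda>R. \<integral>\<^sup>+ t. ennreal ((cmod ((CLBINT x:{-R..R}. iexp (t * x) * complex_of_real (k x)) - \<phi> t))\<^sup>2) \<partial>lborel)
        \<longlongrightarrow> 0) at_top"

definition supported_in_unit_interval :: "(real \<Rightarrow> complex) \<Rightarrow> bool" where
  "supported_in_unit_interval \<phi> \<longleftrightarrow> (\<forall>t. t \<notin> {-1..1} \<longrightarrow> \<phi> t = 0)"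

text \<open>
  Since the value \<open>2\<close> of the Bochner integral is nonzero, \<open>integrates_to_two\<close> entails integrability.
\<close>
definition integrates_to_two :: "(real \<Rightarrow> complex) \<Rightarrow> bool" where
  "integrates_to_two \<phi> \<longleftrightarrow> (CLBINT t. \<phi> t) = 2"

definition condition_F :: "(real \<Rightarrow> real) \<Rightarrow> real \<Rightarrow> bool" where
  "condition_F f \<gamma> \<longleftrightarrow>
     integrable lborel (\<lambda>u. complex_of_real (\<bar>u\<bar> powr \<gamma>) * fourier f u)"

definition condition_K :: "(real \<Rightarrow> complex) \<Rightarrow> real \<Rightarrow> real \<Rightarrow> bool" where
  "condition_K \<phi> \<alpha> \<gamma> \<longleftrightarrow>
     (\<forall>t. \<phi> t \<in> \<real>) \<and> (\<forall>t. \<phi> (-t) = \<phi> t) \<and>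
     supported_in_unit_interval \<phi> \<and> integrates_to_two \<phi> \<and>
     (\<exists>B C :: real.
        (\<lambda>t. \<phi> t - complex_of_real (B * t powr \<gamma>)) \<in> o[at_right 0](\<lambda>t. complex_of_real (t powr \<gamma>)) \<and>
        (\<lambda>t. \<phi> (1 - t) - complex_of_real (C * t powr \<alpha>)) \<in> o[at_right 0](\<lambda>t. complex_of_real (t powr \<alpha>)))"

text \<open>
  The part of the endpoint behaviour in \<open>condition_K\<close> that gives the exponent \<open>\<alpha>\<close> its meaning.
  For a bounded \<open>\<phi>\<close> it is no restriction when \<open>\<alpha> = 0\<close>.
\<close>
definition endpoint_exponent :: "(real \<Rightarrow> complex) \<Rightarrow> real \<Rightarrow> bool" where
  "endpoint_exponent \<phi> \<alpha> \<longleftrightarrow>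
     (\<lambda>t. \<phi> (1 - t)) \<in> O[at_right 0](\<lambda>t. complex_of_real (t powr \<alpha>))"

text \<open>The sample of size \<open>n\<close> is \<open>X 0, \<dots>, X (n - 1)\<close>.\<close>
definition phi_emp :: "(nat \<Rightarrow> 'b \<Rightarrow> real) \<Rightarrow> nat \<Rightarrow> 'b \<Rightarrow> real \<Rightarrow> complex" where
  "phi_emp X n \<omega> t = (1 / of_nat n) * (\<Sum>j<n. iexp (t * X j \<omega>))"

text \<open>
  Complex-valued, because \<open>\<phi>\<close> is; it is real as soon as \<open>\<phi>\<close> is the Fourier transform of a real
  kernel, as \<open>\<phi>(-t)\<close> is then the conjugate of \<open>\<phi>(t)\<close> for almost all \<open>t\<close>.
\<close>
definition p_ng :: "real \<Rightarrow> (real \<Rightarrow> complex) \<Rightarrow> (nat \<Rightarrow> 'b \<Rightarrow> real) \<Rightarrow> nat \<Rightarrow> real \<Rightarrow> 'b \<Rightarrow> complex" where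
  "p_ng \<sigma> \<phi> X n g \<omega> =
     complex_of_real (g / 2) *
     (CLBINT t:{- (1 / g)..1 / g}.
        phi_emp X n \<omega> t * \<phi> (g * t) / complex_of_real (exp (- (\<sigma>\<^sup>2 * t\<^sup>2 / 2))))"

end

theory Submission
  imports Defs
begin

text \<open>
  Averaging the summands \<open>h\<^sub>g(x) = (g/2) \<integral> exp(i t x) \<phi>\<^sub>k(g t) exp(\<sigma>\<^sup>2 t\<^sup>2 / 2) dt\<close> over the sample gives the
  estimator \<open>p\<^sub>n\<^sub>g\<close>, so its mean square error is at most \<open>sup \<bar>h\<^sub>g\<bar>\<^sup>2 / n\<close> plus the squared modulus of the
  bias (lemma \<open>mean_square_error_sample_mean\<close>).

  Bias.  The characteristic function of an observation is
  \<open>(p + (1 - p) \<phi>\<^sub>f(t)) exp(- \<sigma>\<^sup>2 t\<^sup>2 / 2)\<close> (lemma \<open>characteristic_function_mixture\<close>), and the summand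
  is built to cancel the Gaussian factor.  As \<open>\<phi>\<^sub>k\<close> integrates to two, the term \<open>p\<close> is reproduced exactly,
  and the bias is \<open>(1 - p) (g/2) \<integral> \<phi>\<^sub>f(t) \<phi>\<^sub>k(g t) dt\<close>.  It is of order \<open>g\<close> when \<open>\<phi>\<^sub>f\<close> is integrable and of
  order \<open>g\<close> to the power \<open>1 + \<gamma>\<close> under Conditions F and K (lemma \<open>deconv_bias_bound\<close>).

  Variance.  Moving the modulus inside the integral and substituting \<open>s = g t\<close> bounds \<open>\<bar>h\<^sub>g\<bar>\<close> by half of
  \<open>\<integral> \<bar>\<phi>\<^sub>k(s)\<bar> exp(\<sigma>\<^sup>2 s\<^sup>2 / (2 g\<^sup>2)) ds\<close> over \<open>[-1, 1]\<close>.  All the mass sits near the endpoints, where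
  \<open>\<phi>\<^sub>k\<close> vanishes to order \<open>\<alpha>\<close>; a Laplace-type estimate gives the order
  \<open>g\<close> to the power \<open>2 + 2 \<alpha>\<close> times \<open>exp(\<sigma>\<^sup>2 / (2 g\<^sup>2))\<close> (lemma \<open>deconv_summand_bound\<close>), whose square over
  \<open>n\<close> is the second term of the rate.  The order of vanishing is assumed at \<open>1\<close> and transported to
  \<open>-1\<close> by the Hermitian symmetry of the transform of a real function
  (lemma \<open>fourier_transform_hermitian\<close>).

  Consistency follows by Markov's inequality applied to the squared error.
\<close>

section \<open>Symmetry and envelopes of the kernel transform\<close>

text \<open>
  The endpoint condition speaks of the right end \<open>1\<close> of the support only.  Hermitian symmetry, which
  comes from \<open>k\<close> being real, carries it over to the left end.  The truncated transforms
  \<open>F\<^sub>R\<close> are exactly Hermitian; since \<open>\<phi>\<close> is their mean-square limit, the mean-square distance between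
  \<open>\<phi>(-t)\<close> and the conjugate of \<open>\<phi>(t)\<close> is at most four times a quantity tending to \<open>0\<close>, and so it
  vanishes.  An almost-everywhere identity is all that a mean-square limit can give, and all that the
  integrals below need.
\<close>

lemma fourier_transform_hermitian:
  assumes "has_fourier_transform k \<phi>"
  shows "AE t in lborel. \<phi> (- t) = cnj (\<phi> t)"
proof -
  define F where "F = (\<lambda>R t. CLBINT x:{-R..R}. iexp (t * x) * complex_of_real (k x))"
  have [measurable]: "k \<in> borel_measurable borel" "\<phi> \<in> borel_measurable borel"
    and lim: "((\<lambda>R. \<integral>\<^sup>+ t. ennreal ((cmod (F R t - \<phi> t))\<^sup>2) \<partial>lborel) \<longlongrightarrow> 0) at_top"
    using assms by (auto simp: has_fourier_transform_def F_def)
  have [measurable]: "F R \<in> borel_measurable borel" for R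
    unfolding F_def set_lebesgue_integral_def by measurable
  have [measurable]: "cnj \<in> borel_measurable borel"
    by (intro borel_measurable_continuous_onI continuous_intros)
  have F_minus: "F R (- t) = cnj (F R t)" for R t
  proof -
    have "cnj (F R t) = (CLINT x|lborel. cnj (indicator {-R..R} x *\<^sub>R (iexp (t * x) * complex_of_real (k x))))"
      unfolding F_def set_lebesgue_integral_def by (rule Bochner_Integration.integral_cnj[symmetric])
    also have "\<dots> = F R (- t)"
      unfolding F_def set_lebesgue_integral_def
      by (intro Bochner_Integration.integral_cong refl) (auto simp: exp_cnj)
    finally show ?thesis by simp
  qed
  define I where "I = (\<integral>\<^sup>+ t. ennreal ((cmod (\<phi> (- t) - cnj (\<phi> t)))\<^sup>2) \<partial>lborel)"
  have "I \<le> 4 * (\<integral>\<^sup>+ t. ennreal ((cmod (F R t - \<phi> t))\<^sup>2) \<partial>lborel)" for R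
  proof -
    define q where "q = (\<lambda>t. ennreal ((cmod (F R t - \<phi> t))\<^sup>2))"
    have [measurable]: "q \<in> borel_measurable borel"
      unfolding q_def by measurable
    have reflect: "(\<integral>\<^sup>+ t. q (- t) \<partial>lborel) = (\<integral>\<^sup>+ t. q t \<partial>lborel)"
      using nn_integral_real_affine[of q "-1" 0] by simp
    have "ennreal ((cmod (\<phi> (- t) - cnj (\<phi> t)))\<^sup>2) \<le> 2 * q (- t) + 2 * q t" for t
    proof -
      have "cmod (\<phi> (- t) - cnj (\<phi> t)) = cmod ((cnj (F R t) - cnj (\<phi> t)) - (F R (- t) - \<phi> (- t)))"
        by (simp add: F_minus)
      also have "\<dots> \<le> cmod (F R t - \<phi> t) + cmod (F R (- t) - \<phi> (- t))"
        by (metis norm_triangle_ineq4 complex_cnj_diff complex_mod_cnj)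
      finally have "(cmod (\<phi> (- t) - cnj (\<phi> t)))\<^sup>2
          \<le> (cmod (F R t - \<phi> t) + cmod (F R (- t) - \<phi> (- t)))\<^sup>2"
        by (intro power_mono) auto
      also have "\<dots> \<le> 2 * (cmod (F R (- t) - \<phi> (- t)))\<^sup>2 + 2 * (cmod (F R t - \<phi> t))\<^sup>2"
        using sum_squares_bound[of "cmod (F R t - \<phi> t)" "cmod (F R (- t) - \<phi> (- t))"]
        by (simp add: power2_sum)
      finally show ?thesis
        unfolding q_def by (simp add: ennreal_plus[symmetric] ennreal_mult'[symmetric]
            flip: ennreal_numeral del: ennreal_plus)
    qed
    then have "I \<le> (\<integral>\<^sup>+ t. 2 * q (- t) + 2 * q t \<partial>lborel)"
      unfolding I_def by (intro nn_integral_mono)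
    also have "\<dots> = 2 * (\<integral>\<^sup>+ t. q t \<partial>lborel) + 2 * (\<integral>\<^sup>+ t. q t \<partial>lborel)"
      by (simp add: nn_integral_add nn_integral_cmult reflect)
    also have "\<dots> = 4 * (\<integral>\<^sup>+ t. q t \<partial>lborel)"
      by (simp flip: distrib_right)
    finally show ?thesis unfolding q_def .
  qed
  moreover have "((\<lambda>R. 4 * (\<integral>\<^sup>+ t. ennreal ((cmod (F R t - \<phi> t))\<^sup>2) \<partial>lborel)) \<longlongrightarrow> 4 * 0) at_top"
    by (intro ennreal_tendsto_cmult lim) simp
  ultimately have "I \<le> 4 * 0"
    by (intro tendsto_lowerbound[OF _ always_eventually]) auto
  then have "I = 0" by simp
  then have "AE t in lborel. ennreal ((cmod (\<phi> (- t) - cnj (\<phi> t)))\<^sup>2) = 0"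
    unfolding I_def by (subst (asm) nn_integral_0_iff_AE) auto
  then show ?thesis by eventually_elim (simp add: ennreal_eq_0_iff)
qed

text \<open>
  Makes a local order bound global on \<open>(0, 1]\<close>: away from \<open>0\<close> the function is bounded and \<open>t powr a\<close>
  is bounded below.  Explicit global envelopes let the later estimates hold for every bandwidth, not
  just for small ones.
\<close>

lemma bigo_at_right_zero_bound:
  fixes F :: "real \<Rightarrow> complex" and a K :: real
  assumes big: "F \<in> O[at_right 0](\<lambda>t. complex_of_real (t powr a))"
    and bdd: "\<And>t. cmod (F t) \<le> K" and "0 \<le> a"
  obtains C where "0 \<le> C" "\<And>t. 0 < t \<Longrightarrow> t \<le> 1 \<Longrightarrow> cmod (F t) \<le> C * t powr a"
proof -
  from big obtain c where c: "c > 0"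
      "eventually (\<lambda>t. cmod (F t) \<le> c * cmod (complex_of_real (t powr a))) (at_right 0)"
    by (elim landau_o.bigE) 
  then obtain b where b: "b > 0" "\<And>t. 0 < t \<Longrightarrow> t < b \<Longrightarrow> cmod (F t) \<le> c * t powr a"
    unfolding eventually_at_right_field by auto
  have K: "0 \<le> K" using bdd[of 0] norm_ge_zero order_trans by blast
  show thesis
  proof (rule that[of "c + K / b powr a"])
    show "0 \<le> c + K / b powr a" using c K by simp
    fix t :: real assume t: "0 < t" "t \<le> 1"
    show "cmod (F t) \<le> (c + K / b powr a) * t powr a"
    proof (cases "t < b")
      case True
      then have "cmod (F t) \<le> c * t powr a" using b t by simp
      also have "\<dots> \<le> (c + K / b powr a) * t powr a" using K by (intro mult_right_mono) auto
      finally show ?thesis .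
    next
      case False
      then have "1 \<le> t powr a / b powr a"
        using b \<open>0 \<le> a\<close> by (simp add: powr_mono2)
      then have "K * 1 \<le> K * (t powr a / b powr a)" using K by (rule mult_left_mono)
      also have "\<dots> \<le> (c + K / b powr a) * t powr a"
        using c by (simp add: algebra_simps)
      finally show ?thesis using bdd[of t] by simp
    qed
  qed
qed

text \<open>
  The bound holds almost everywhere only, for two reasons: the symmetry that covers the negative half
  is itself an almost-everywhere identity, and the order condition says nothing about the values of
  \<open>\<phi>\<close> at \<open>1\<close> and \<open>-1\<close>, where the envelope is \<open>0\<close>.
\<close>

lemma endpoint_envelope:
  assumes "endpoint_exponent \<phi> \<alpha>" and "0 \<le> \<alpha>" and bdd: "\<And>t. cmod (\<phi> t) \<le> K"
    and hermitian: "AE t in lborel. \<phi> (- t) = cnj (\<phi> t)"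
  obtains C where "0 \<le> C"
    "AE s in lborel. \<bar>s\<bar> \<le> 1 \<longrightarrow> cmod (\<phi> s) \<le> C * (1 - \<bar>s\<bar>) powr \<alpha>"
proof -
  obtain C where C: "0 \<le> C" "\<And>t. 0 < t \<Longrightarrow> t \<le> 1 \<Longrightarrow> cmod (\<phi> (1 - t)) \<le> C * t powr \<alpha>"
    using assms(1) unfolding endpoint_exponent_def
    by (rule bigo_at_right_zero_bound[OF _ bdd assms(2)]) blast
  have right: "cmod (\<phi> s) \<le> C * (1 - s) powr \<alpha>" if "0 \<le> s" "s < 1" for s
    using C(2)[of "1 - s"] that by simp
  have "AE s in lborel. \<bar>s\<bar> \<le> 1 \<longrightarrow> cmod (\<phi> s) \<le> C * (1 - \<bar>s\<bar>) powr \<alpha>"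
    using hermitian AE_lborel_singleton[of "1::real"] AE_lborel_singleton[of "-1::real"]
  proof eventually_elim
    case (elim s)
    show ?case
    proof (cases "0 \<le> s")
      case True then show ?thesis using right[of s] elim by auto
    next
      case False
      have "cmod (\<phi> s) = cmod (\<phi> (- s))" using elim by simp
      then show ?thesis using right[of "- s"] elim False by auto
    qed
  qed
  with C(1) show thesis by (rule that)
qed

lemma condition_K_endpoint_exponent:
  assumes "condition_K \<phi> \<alpha> \<gamma>"
  shows "endpoint_exponent \<phi> \<alpha>"
proof -
  obtain C where "(\<lambda>t. \<phi> (1 - t) - complex_of_real (C * t powr \<alpha>))
      \<in> o[at_right 0](\<lambda>t. complex_of_real (t powr \<alpha>))"
    using assms unfolding condition_K_def by blast
  then have "(\<lambda>t. (\<phi> (1 - t) - complex_of_real (C * t powr \<alpha>)) + complex_of_real (C * t powr \<alpha>))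
      \<in> O[at_right 0](\<lambda>t. complex_of_real (t powr \<alpha>))"
    by (rule sum_in_bigo(1)[OF landau_o.small_imp_big]) (cases "C = 0", simp_all)
  then show ?thesis by (simp add: endpoint_exponent_def)
qed

text \<open>
  The point \<open>0\<close> is excluded: the one-sided expansion leaves \<open>\<phi>(0)\<close> unconstrained.
\<close>

lemma condition_K_origin_bound:
  assumes "condition_K \<phi> \<alpha> \<gamma>" and bdd: "\<And>t. cmod (\<phi> t) \<le> K" and "0 \<le> \<gamma>"
  obtains C where "0 \<le> C" "\<And>s. s \<noteq> 0 \<Longrightarrow> cmod (\<phi> s) \<le> C * \<bar>s\<bar> powr \<gamma>"
proof -
  obtain B where "(\<lambda>t. \<phi> t - complex_of_real (B * t powr \<gamma>))
      \<in> o[at_right 0](\<lambda>t. complex_of_real (t powr \<gamma>))"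
    using assms unfolding condition_K_def by blast
  then have "(\<lambda>t. (\<phi> t - complex_of_real (B * t powr \<gamma>)) + complex_of_real (B * t powr \<gamma>))
      \<in> O[at_right 0](\<lambda>t. complex_of_real (t powr \<gamma>))"
    by (rule sum_in_bigo(1)[OF landau_o.small_imp_big]) (cases "B = 0", simp_all)
  then have "\<phi> \<in> O[at_right 0](\<lambda>t. complex_of_real (t powr \<gamma>))" by simp
  then obtain C where C: "0 \<le> C" "\<And>t. 0 < t \<Longrightarrow> t \<le> 1 \<Longrightarrow> cmod (\<phi> t) \<le> C * t powr \<gamma>"
    by (rule bigo_at_right_zero_bound[OF _ bdd assms(3)]) blast
  have sym: "\<phi> (- s) = \<phi> s" for s
    using assms(1) by (simp add: condition_K_def)
  have supp: "\<phi> s = 0" if "\<bar>s\<bar> > 1" for s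
  proof -
    have "s \<notin> {-1..1}" using that by auto
    then show ?thesis using assms(1) by (simp add: condition_K_def supported_in_unit_interval_def)
  qed
  have "cmod (\<phi> s) \<le> C * \<bar>s\<bar> powr \<gamma>" if "s \<noteq> 0" for s
  proof (cases "\<bar>s\<bar> \<le> 1")
    case True
    have "\<phi> s = \<phi> \<bar>s\<bar>" using sym[of s] by (simp add: abs_if)
    with C(2)[of "\<bar>s\<bar>"] that True show ?thesis by simp
  next
    case False
    with supp[of s] C(1) show ?thesis by simp
  qed
  with C(1) show thesis by (rule that)
qed

section \<open>Exponentially weighted integrals with mass at the endpoints\<close>

lemma nn_integral_powr_exp_decay:
  fixes \<alpha> l :: real
  assumes "0 \<le> \<alpha>" "0 < l"
  shows "(\<integral>\<^sup>+ v. ennreal (indicator {0..} v * v powr \<alpha> * exp (- l * v)) \<partial>lborel)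
       = ennreal (Gamma (\<alpha> + 1) * l powr (- (\<alpha> + 1)))"
proof -
  define G where "G = (\<lambda>v::real. ennreal (indicator {0..} v * v powr \<alpha> * exp (- l * v)))"
  have [measurable]: "G \<in> borel_measurable borel" unfolding G_def by measurable
  have "(\<integral>\<^sup>+ v. G v \<partial>lborel) = ennreal (1 / l) * (\<integral>\<^sup>+ t. G (0 + (1 / l) * t) \<partial>lborel)"
    using nn_integral_real_affine[of G "1 / l" 0] assms by simp
  also have "(\<lambda>t. G (0 + (1 / l) * t))
      = (\<lambda>t. ennreal (l powr (- \<alpha>)) * ennreal (indicator {0..} t * t powr (\<alpha> + 1 - 1) / exp t))"
    using assms by (intro ext)
      (auto simp: G_def indicator_def zero_le_divide_iff powr_divide powr_minus exp_minus
         field_simps simp flip: ennreal_mult')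
  also have "(\<integral>\<^sup>+ t. ennreal (l powr (- \<alpha>)) * ennreal (indicator {0..} t * t powr (\<alpha> + 1 - 1) / exp t) \<partial>lborel)
      = ennreal (l powr (- \<alpha>)) * ennreal (Gamma (\<alpha> + 1))"
    using assms by (subst nn_integral_cmult) (auto simp: Gamma_conv_nn_integral_real)
  also have "ennreal (1 / l) * (ennreal (l powr (- \<alpha>)) * ennreal (Gamma (\<alpha> + 1)))
      = ennreal (Gamma (\<alpha> + 1) * l powr (- (\<alpha> + 1)))"
    using assms by (simp add: powr_diff powr_minus divide_simps flip: ennreal_mult')
  finally show ?thesis unfolding G_def .
qed

text \<open>
  For large \<open>l\<close> the weight \<open>exp (l s\<^sup>2)\<close> concentrates at distance of order \<open>1/l\<close> from the endpoints, so a
  factor vanishing there to order \<open>\<alpha>\<close> gains \<open>l powr (- (\<alpha> + 1))\<close> over \<open>exp l\<close>.  The crude inequality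
  \<open>s\<^sup>2 \<le> \<bar>s\<bar> = 1 - (1 - \<bar>s\<bar>)\<close> on \<open>[-1, 1]\<close> already shows this: it dominates the weight by
  \<open>exp l\<close> times an exponential in the distance \<open>1 - \<bar>s\<bar>\<close>, whose integral is a Gamma function.
\<close>

lemma nn_integral_endpoint_exp:
  fixes \<alpha> l :: real
  assumes "0 \<le> \<alpha>" "0 < l"
  shows "(\<integral>\<^sup>+ s. ennreal (indicator {-1..1} s * (1 - \<bar>s\<bar>) powr \<alpha> * exp (l * s\<^sup>2)) \<partial>lborel)
       \<le> ennreal (2 * exp l * Gamma (\<alpha> + 1) * l powr (- (\<alpha> + 1)))"
proof -
  define G where "G = (\<lambda>v::real. ennreal (indicator {0..} v * v powr \<alpha> * exp (- l * v)))"
  have [measurable]: "G \<in> borel_measurable borel" unfolding G_def by measurable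
  have G_int: "(\<integral>\<^sup>+ v. G v \<partial>lborel) = ennreal (Gamma (\<alpha> + 1) * l powr (- (\<alpha> + 1)))"
    unfolding G_def by (rule nn_integral_powr_exp_decay[OF assms])
  have le: "ennreal (indicator {-1..1} s * (1 - \<bar>s\<bar>) powr \<alpha> * exp (l * s\<^sup>2))
      \<le> ennreal (exp l) * (G (1 - s) + G (1 + s))" for s :: real
  proof (cases "s \<in> {-1..1}")
    case True
    have "s\<^sup>2 \<le> \<bar>s\<bar>"
      using True mult_left_le[of "\<bar>s\<bar>" "\<bar>s\<bar>"] by (simp add: power2_eq_square abs_le_iff)
    then have "l * s\<^sup>2 \<le> l * \<bar>s\<bar>"
      using assms by (intro mult_left_mono) auto
    then have "exp (l * s\<^sup>2) \<le> exp l * exp (- l * (1 - \<bar>s\<bar>))"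
      by (simp add: algebra_simps flip: exp_add)
    then have "(1 - \<bar>s\<bar>) powr \<alpha> * exp (l * s\<^sup>2)
        \<le> (1 - \<bar>s\<bar>) powr \<alpha> * (exp l * exp (- l * (1 - \<bar>s\<bar>)))"
      by (rule mult_left_mono) simp
    also have "\<dots> = exp l * ((1 - \<bar>s\<bar>) powr \<alpha> * exp (- l * (1 - \<bar>s\<bar>)))"
      by simp
    finally have "ennreal (indicator {-1..1} s * (1 - \<bar>s\<bar>) powr \<alpha> * exp (l * s\<^sup>2)) \<le> ennreal (exp l) * G (1 - \<bar>s\<bar>)"
      using True by (auto simp: G_def simp flip: ennreal_mult')
    also have "\<dots> \<le> ennreal (exp l) * (G (1 - s) + G (1 + s))"
      by (intro mult_left_mono) (auto simp: abs_if)
    finally show ?thesis .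
  qed simp
  have "(\<integral>\<^sup>+ s. ennreal (indicator {-1..1} s * (1 - \<bar>s\<bar>) powr \<alpha> * exp (l * s\<^sup>2)) \<partial>lborel)
      \<le> (\<integral>\<^sup>+ s. ennreal (exp l) * (G (1 - s) + G (1 + s)) \<partial>lborel)"
    by (intro nn_integral_mono le)
  also have "\<dots> = ennreal (exp l) * ((\<integral>\<^sup>+ s. G (1 - s) \<partial>lborel) + (\<integral>\<^sup>+ s. G (1 + s) \<partial>lborel))"
    by (simp add: nn_integral_cmult nn_integral_add)
  also have "(\<integral>\<^sup>+ s. G (1 - s) \<partial>lborel) = (\<integral>\<^sup>+ v. G v \<partial>lborel)"
    using nn_integral_real_affine[of G "-1" 1] by simp
  also have "(\<integral>\<^sup>+ s. G (1 + s) \<partial>lborel) = (\<integral>\<^sup>+ v. G v \<partial>lborel)"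
    using nn_integral_real_affine[of G 1 1] by simp
  also have "ennreal (exp l) * ((\<integral>\<^sup>+ v. G v \<partial>lborel) + (\<integral>\<^sup>+ v. G v \<partial>lborel))
      = ennreal (2 * exp l * Gamma (\<alpha> + 1) * l powr (- (\<alpha> + 1)))"
    using assms Gamma_real_pos[of "\<alpha> + 1"]
    unfolding G_int by (simp flip: ennreal_plus ennreal_mult')
  finally show ?thesis .
qed

section \<open>Mean square error of a sample mean\<close>

lemma (in prob_space) expectation_square_sum_centred:
  fixes Y :: "nat \<Rightarrow> 'a \<Rightarrow> real"
  assumes indep: "indep_vars (\<lambda>_. borel) Y UNIV"
    and bdd: "\<And>j \<omega>. \<bar>Y j \<omega>\<bar> \<le> B" and centred: "\<And>j. expectation (Y j) = 0"
  shows "expectation (\<lambda>\<omega>. (\<Sum>j<n. Y j \<omega>)\<^sup>2) = (\<Sum>j<n. expectation (\<lambda>\<omega>. (Y j \<omega>)\<^sup>2))"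
proof (induction n)
  case (Suc n)
  have [measurable]: "Y j \<in> borel_measurable M" for j
    using indep by (simp add: indep_vars_def)
  have [simp]: "integrable M (Y j)" for j
    by (rule integrable_const_bound[of _ B]) (use bdd in auto)
  have B: "0 \<le> B" using bdd[of 0 undefined] by linarith
  have int2: "integrable M (\<lambda>\<omega>. Y i \<omega> * Y j \<omega>)" for i j
    by (rule integrable_const_bound[of _ "B * B"])
       (use bdd B in \<open>auto simp: abs_mult intro!: mult_mono\<close>)
  have orth: "expectation (\<lambda>\<omega>. Y i \<omega> * Y j \<omega>) = 0" if "i \<noteq> j" for i j
  proof -
    have "indep_vars (\<lambda>_. borel) Y {i, j}"
      by (rule indep_vars_subset[OF indep]) simp
    then have "expectation (\<lambda>\<omega>. \<Prod>l\<in>{i, j}. Y l \<omega>) = (\<Prod>l\<in>{i, j}. expectation (Y l))"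
      by (intro indep_vars_lebesgue_integral) auto
    then show ?thesis using that by (simp add: centred)
  qed
  have "expectation (\<lambda>\<omega>. (\<Sum>j<Suc n. Y j \<omega>)\<^sup>2)
      = expectation (\<lambda>\<omega>. (\<Sum>j<n. Y j \<omega>)\<^sup>2 + (Y n \<omega>)\<^sup>2 + 2 * (\<Sum>j<n. Y j \<omega> * Y n \<omega>))"
    by (intro Bochner_Integration.integral_cong refl)
       (simp add: power2_sum sum_distrib_right mult.assoc)
  also have "\<dots> = expectation (\<lambda>\<omega>. (\<Sum>j<n. Y j \<omega>)\<^sup>2) + expectation (\<lambda>\<omega>. (Y n \<omega>)\<^sup>2)
      + 2 * (\<Sum>j<n. expectation (\<lambda>\<omega>. Y j \<omega> * Y n \<omega>))"
  proof -
    have "integrable M (\<lambda>\<omega>. (\<Sum>j<n. Y j \<omega>)\<^sup>2)" "integrable M (\<lambda>\<omega>. (Y n \<omega>)\<^sup>2)"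
      using int2 by (auto simp: power2_eq_square sum_product intro!: Bochner_Integration.integrable_sum)
    then show ?thesis
      using int2 by (simp add: Bochner_Integration.integral_add Bochner_Integration.integral_sum)
  qed
  also have "(\<Sum>j<n. expectation (\<lambda>\<omega>. Y j \<omega> * Y n \<omega>)) = 0"
    by (intro sum.neutral) (auto intro: orth)
  finally show ?case by (simp add: Suc.IH)
qed simp

text \<open>
  Variance plus squared bias.  The variance of a single summand is replaced by its second moment,
  which loses nothing in the rate below.
\<close>

lemma (in prob_space) mean_square_error_sample_mean_real:
  fixes h :: "real \<Rightarrow> real" and X :: "nat \<Rightarrow> 'a \<Rightarrow> real"
  assumes indep: "indep_vars (\<lambda>_. borel) X UNIV"
    and distr: "\<And>j. distr M borel (X j) = P"
    and h [measurable]: "h \<in> borel_measurable borel" and bdd: "\<And>x. \<bar>h x\<bar> \<le> B" and "0 < n"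
  shows "expectation (\<lambda>\<omega>. ((\<Sum>j<n. h (X j \<omega>)) / real n - c)\<^sup>2)
       \<le> (\<integral>x. (h x)\<^sup>2 \<partial>P) / real n + ((\<integral>x. h x \<partial>P) - c)\<^sup>2"
proof -
  define m where "m = (\<integral>x. h x \<partial>P)"
  have X [measurable]: "X j \<in> borel_measurable M" for j
    using indep by (simp add: indep_vars_def)
  have transfer: "expectation (\<lambda>\<omega>. u (X j \<omega>)) = (\<integral>x. u x \<partial>P)"
    if "u \<in> borel_measurable borel" for u :: "real \<Rightarrow> real" and j
    using that by (simp add: integral_distr flip: distr[of j])
  define Y where "Y = (\<lambda>j \<omega>. h (X j \<omega>) - m)"
  have hX: "integrable M (\<lambda>\<omega>. h (X j \<omega>))" for j
    by (rule integrable_const_bound[of _ B]) (use bdd in auto)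
  have B: "0 \<le> B" using bdd[of 0] by linarith
  have hX2: "integrable M (\<lambda>\<omega>. (h (X j \<omega>))\<^sup>2)" for j
    by (rule integrable_const_bound[of _ "B * B"])
       (use bdd B in \<open>auto simp: abs_mult power2_eq_square simp del: abs_mult_self_eq intro!: mult_mono\<close>)
  have Ybdd: "\<bar>Y j \<omega>\<bar> \<le> B + \<bar>m\<bar>" for j \<omega>
    using bdd[of "X j \<omega>"] by (simp add: Y_def)
  have Ymeas [measurable]: "Y j \<in> borel_measurable M" for j
    unfolding Y_def by measurable
  have Y0: "expectation (Y j) = 0" for j
    using hX by (simp add: Y_def transfer m_def prob_space)
  have Yind: "indep_vars (\<lambda>_. borel) Y UNIV"
    unfolding Y_def by (rule indep_vars_compose2[OF indep]) measurable
  have Y2: "expectation (\<lambda>\<omega>. (Y j \<omega>)\<^sup>2) \<le> (\<integral>x. (h x)\<^sup>2 \<partial>P)" for j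
  proof -
    have "expectation (\<lambda>\<omega>. (Y j \<omega>)\<^sup>2) = expectation (\<lambda>\<omega>. (h (X j \<omega>))\<^sup>2) - m\<^sup>2"
      using variance_eq[OF hX hX2, of j] by (simp add: Y_def transfer m_def)
    then show ?thesis using transfer[of "\<lambda>x. (h x)\<^sup>2" j] by simp
  qed
  define S where "S = (\<lambda>\<omega>. \<Sum>j<n. Y j \<omega>)"
  have Sint: "integrable M S"
    unfolding S_def by (intro Bochner_Integration.integrable_sum integrable_const_bound[of _ "B + \<bar>m\<bar>"])
      (use Ybdd in auto)
  have S2int: "integrable M (\<lambda>\<omega>. (S \<omega>)\<^sup>2)"
    unfolding S_def power2_eq_square sum_product
    by (intro Bochner_Integration.integrable_sum integrable_const_bound[of _ "(B + \<bar>m\<bar>) * (B + \<bar>m\<bar>)"])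
       (use Ybdd B in \<open>auto simp: abs_mult intro!: mult_mono\<close>)
  have S0: "expectation S = 0"
    unfolding S_def using Y0 Ybdd
    by (subst Bochner_Integration.integral_sum) (auto intro!: integrable_const_bound[of _ "B + \<bar>m\<bar>"])
  have "expectation (\<lambda>\<omega>. ((\<Sum>j<n. h (X j \<omega>)) / real n - c)\<^sup>2)
      = expectation (\<lambda>\<omega>. (S \<omega>)\<^sup>2 / (real n)\<^sup>2 + (2 * (m - c) / real n) * S \<omega> + (m - c)\<^sup>2)"
  proof (intro Bochner_Integration.integral_cong refl)
    fix \<omega>
    have eq: "(\<Sum>j<n. h (X j \<omega>)) / real n - c = S \<omega> / real n + (m - c)"
      using \<open>0 < n\<close> by (simp add: S_def Y_def sum_subtractf field_simps)
    show "((\<Sum>j<n. h (X j \<omega>)) / real n - c)\<^sup>2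
        = (S \<omega>)\<^sup>2 / (real n)\<^sup>2 + (2 * (m - c) / real n) * S \<omega> + (m - c)\<^sup>2"
      unfolding eq by (simp add: power2_sum power_divide)
  qed
  also have "\<dots> = expectation (\<lambda>\<omega>. (S \<omega>)\<^sup>2) / (real n)\<^sup>2 + (m - c)\<^sup>2"
    using Sint S2int by (simp add: S0 prob_space)
  also have "expectation (\<lambda>\<omega>. (S \<omega>)\<^sup>2) = (\<Sum>j<n. expectation (\<lambda>\<omega>. (Y j \<omega>)\<^sup>2))"
    unfolding S_def by (rule expectation_square_sum_centred[OF Yind Ybdd Y0])
  also have "\<dots> \<le> real n * (\<integral>x. (h x)\<^sup>2 \<partial>P)"
    using sum_bounded_above[of "{..<n}" "\<lambda>j. expectation (\<lambda>\<omega>. (Y j \<omega>)\<^sup>2)"] Y2 by simp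
  finally show ?thesis
    using \<open>0 < n\<close> by (simp add: m_def divide_right_mono power2_eq_square)
qed

text \<open>
  Adding the real case for \<open>Re h\<close> and \<open>Im h\<close> restores the constant \<open>B\<^sup>2\<close>, because the two second moments
  add up to that of \<open>cmod h\<close>.
\<close>

lemma (in prob_space) mean_square_error_sample_mean:
  fixes h :: "real \<Rightarrow> complex" and X :: "nat \<Rightarrow> 'a \<Rightarrow> real"
  assumes indep: "indep_vars (\<lambda>_. borel) X UNIV"
    and distr: "\<And>j. distr M borel (X j) = P"
    and h [measurable]: "h \<in> borel_measurable borel" and bdd: "\<And>x. cmod (h x) \<le> B" and "0 < n"
  shows "expectation (\<lambda>\<omega>. (cmod ((\<Sum>j<n. h (X j \<omega>)) / of_nat n - c))\<^sup>2)
       \<le> B\<^sup>2 / real n + (cmod ((\<integral>x. h x \<partial>P) - c))\<^sup>2"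
proof -
  have X [measurable]: "X j \<in> borel_measurable M" for j
    using indep by (simp add: indep_vars_def)
  interpret P: prob_space P
    unfolding distr[of 0, symmetric] by (rule prob_space_distr) simp
  have [measurable_cong, simp]: "sets P = sets borel"
    by (simp flip: distr[of 0])
  have hint: "integrable P h"
    by (rule P.integrable_const_bound[of _ B]) (use bdd in auto)
  have B: "0 \<le> B" using bdd[of 0] norm_ge_zero order_trans by blast
  have re: "\<bar>Re (h x)\<bar> \<le> B" and im: "\<bar>Im (h x)\<bar> \<le> B" for x
    using bdd[of x] abs_Re_le_cmod[of "h x"] abs_Im_le_cmod[of "h x"] by linarith+
  define A where "A = (\<lambda>\<omega>. (\<Sum>j<n. h (X j \<omega>)) / of_nat n - c)"
  have Abdd: "cmod (A \<omega>) \<le> B + cmod c" for \<omega>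
  proof -
    have "cmod (\<Sum>j<n. h (X j \<omega>)) \<le> real n * B"
      using sum_norm_bound[of "{..<n}" "\<lambda>j. h (X j \<omega>)" B] bdd by simp
    then have "cmod ((\<Sum>j<n. h (X j \<omega>)) / of_nat n) \<le> B"
      using \<open>0 < n\<close> by (simp add: norm_divide field_simps)
    then show ?thesis unfolding A_def
      by (meson add_right_mono norm_triangle_ineq4 order_trans)
  qed
  have [measurable]: "A \<in> borel_measurable M" unfolding A_def by measurable
  have sq: "integrable M (\<lambda>\<omega>. (u (A \<omega>))\<^sup>2)"
    if "u \<in> borel_measurable borel" "\<And>z. \<bar>u z\<bar> \<le> cmod z" for u :: "complex \<Rightarrow> real"
  proof (rule integrable_const_bound[of _ "(B + cmod c)\<^sup>2"])
    show "AE \<omega> in M. norm ((u (A \<omega>))\<^sup>2) \<le> (B + cmod c)\<^sup>2"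
      using that(2) Abdd B by (auto simp: abs_le_square_iff[symmetric] intro: order_trans)
  qed (use that(1) in measurable)
  have sqP: "integrable P (\<lambda>x. (u (h x))\<^sup>2)"
    if "u \<in> borel_measurable borel" "\<And>z. \<bar>u z\<bar> \<le> cmod z" for u :: "complex \<Rightarrow> real"
  proof (rule P.integrable_const_bound[of _ "B\<^sup>2"])
    show "AE x in P. norm ((u (h x))\<^sup>2) \<le> B\<^sup>2"
      using that(2) bdd B by (auto simp: abs_le_square_iff[symmetric] intro: order_trans)
  qed (use that(1) in measurable)
  have "expectation (\<lambda>\<omega>. (cmod (A \<omega>))\<^sup>2) = expectation (\<lambda>\<omega>. (Re (A \<omega>))\<^sup>2) + expectation (\<lambda>\<omega>. (Im (A \<omega>))\<^sup>2)"
    unfolding cmod_power2 using sq[of Re] sq[of Im]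
    by (intro Bochner_Integration.integral_add) (auto simp: abs_Re_le_cmod abs_Im_le_cmod)
  also have "expectation (\<lambda>\<omega>. (Re (A \<omega>))\<^sup>2)
      \<le> (\<integral>x. (Re (h x))\<^sup>2 \<partial>P) / real n + ((\<integral>x. Re (h x) \<partial>P) - Re c)\<^sup>2"
    using mean_square_error_sample_mean_real[where h = "\<lambda>x. Re (h x)" and c = "Re c", OF indep distr _ re \<open>0 < n\<close>]
    by (simp add: A_def Re_divide_of_nat)
  also have "expectation (\<lambda>\<omega>. (Im (A \<omega>))\<^sup>2)
      \<le> (\<integral>x. (Im (h x))\<^sup>2 \<partial>P) / real n + ((\<integral>x. Im (h x) \<partial>P) - Im c)\<^sup>2"
    using mean_square_error_sample_mean_real[where h = "\<lambda>x. Im (h x)" and c = "Im c", OF indep distr _ im \<open>0 < n\<close>]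
    by (simp add: A_def Im_divide_of_nat)
  also have "(\<integral>x. (Re (h x))\<^sup>2 \<partial>P) / real n + ((\<integral>x. Re (h x) \<partial>P) - Re c)\<^sup>2
      + ((\<integral>x. (Im (h x))\<^sup>2 \<partial>P) / real n + ((\<integral>x. Im (h x) \<partial>P) - Im c)\<^sup>2)
      = (\<integral>x. (cmod (h x))\<^sup>2 \<partial>P) / real n + (cmod ((\<integral>x. h x \<partial>P) - c))\<^sup>2"
  proof -
    have "(\<integral>x. (cmod (h x))\<^sup>2 \<partial>P) = (\<integral>x. (Re (h x))\<^sup>2 \<partial>P) + (\<integral>x. (Im (h x))\<^sup>2 \<partial>P)"
      unfolding cmod_power2 using sqP[of Re] sqP[of Im]
      by (intro Bochner_Integration.integral_add) (auto simp: abs_Re_le_cmod abs_Im_le_cmod)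
    then show ?thesis
      using hint by (simp add: cmod_power2 add_divide_distrib)
  qed
  also have "(\<integral>x. (cmod (h x))\<^sup>2 \<partial>P) \<le> (\<integral>x. B\<^sup>2 \<partial>P)"
    using sqP[of cmod] bdd by (intro integral_mono) (auto intro: power_mono)
  finally show ?thesis
    by (simp add: A_def P.prob_space divide_right_mono)
qed

section \<open>Characteristic function of the observations\<close>

text \<open>
  Almost surely \<open>U\<close> is \<open>0\<close> or \<open>1\<close>, so \<open>exp(i t U V)\<close> equals the indicator of \<open>U = 0\<close> plus the indicator of
  \<open>U = 1\<close> times \<open>exp(i t V)\<close>.  Each of the two terms, multiplied by the Gaussian factor, is a product of
  functions of the independent variables \<open>U\<close>, \<open>V\<close>, \<open>Z\<close>.  The atom at \<open>0\<close> thus shows up as the part \<open>p\<close> of the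
  characteristic function that does not decay after deconvolution.
\<close>

lemma (in prob_space) characteristic_function_mixture:
  assumes indep: "indep_vars (\<lambda>_. borel) (\<lambda>i. [U, V, Z] ! i) {..<3}"
    and U0: "measure M {\<omega> \<in> space M. U \<omega> = 0} = p"
    and U1: "measure M {\<omega> \<in> space M. U \<omega> = 1} = 1 - p"
    and f: "\<And>x. f x \<ge> 0" "distributed M lborel V (\<lambda>x. ennreal (f x))"
    and Z: "distributed M lborel Z (\<lambda>x. ennreal (std_normal_density x))"
  shows "expectation (\<lambda>\<omega>. iexp (t * (U \<omega> * V \<omega> + \<sigma> * Z \<omega>)))
       = (complex_of_real p + complex_of_real (1 - p) * fourier f t)
         * complex_of_real (exp (- (\<sigma>\<^sup>2 * t\<^sup>2 / 2)))"
proof -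
  have meas: "([U, V, Z] ! i) \<in> borel_measurable M" if "i < 3" for i
    using indep that by (simp add: indep_vars_def)
  have [measurable]: "U \<in> borel_measurable M" "V \<in> borel_measurable M" "Z \<in> borel_measurable M"
    using meas[of 0] meas[of 1] meas[of 2] by (simp_all add: numeral_2_eq_2)
  have set3: "{..<3::nat} = {0, 1, 2}" by auto
  have split: "expectation (\<lambda>\<omega>. a (U \<omega>) * (b (V \<omega>) * c (Z \<omega>)))
      = expectation (\<lambda>\<omega>. a (U \<omega>)) * (expectation (\<lambda>\<omega>. b (V \<omega>)) * expectation (\<lambda>\<omega>. c (Z \<omega>)))"
    if [measurable]: "a \<in> borel_measurable borel" "b \<in> borel_measurable borel" "c \<in> borel_measurable borel"
      and bdd: "\<And>x. cmod (a x) \<le> 1" "\<And>x. cmod (b x) \<le> 1" "\<And>x. cmod (c x) \<le> 1"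
    for a b c :: "real \<Rightarrow> complex"
  proof -
    have "indep_vars (\<lambda>_. borel) (\<lambda>i \<omega>. ([a, b, c] ! i) (([U, V, Z] ! i) \<omega>)) {..<3}"
      by (rule indep_vars_compose2[OF indep]) (auto simp: set3)
    then have "expectation (\<lambda>\<omega>. \<Prod>i<3. ([a, b, c] ! i) (([U, V, Z] ! i) \<omega>))
        = (\<Prod>i<3. expectation (\<lambda>\<omega>. ([a, b, c] ! i) (([U, V, Z] ! i) \<omega>)))"
      using bdd by (intro indep_vars_lebesgue_integral)
        (auto simp: set3 intro!: integrable_const_bound[of _ 1])
    then show ?thesis by (simp add: set3)
  qed
  define e0 e1 :: "real \<Rightarrow> complex" where "e0 = indicator {0}" and "e1 = indicator {1}"
  have [measurable]: "e0 \<in> borel_measurable borel" "e1 \<in> borel_measurable borel"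
    by (simp_all add: e0_def e1_def)
  have e_le: "cmod (e0 x) \<le> 1" "cmod (e1 x) \<le> 1" for x
    by (simp_all add: e0_def e1_def indicator_def)
  have Ee0: "expectation (\<lambda>\<omega>. e0 (U \<omega>)) = complex_of_real p"
  proof -
    have "expectation (\<lambda>\<omega>. e0 (U \<omega>)) = expectation (\<lambda>\<omega>. complex_of_real (indicator {\<omega> \<in> space M. U \<omega> = 0} \<omega>))"
      by (intro Bochner_Integration.integral_cong refl) (auto simp: e0_def indicator_def)
    then show ?thesis by (simp add: U0 del: of_real_indicator)
  qed
  have Ee1: "expectation (\<lambda>\<omega>. e1 (U \<omega>)) = complex_of_real (1 - p)"
  proof -
    have "expectation (\<lambda>\<omega>. e1 (U \<omega>)) = expectation (\<lambda>\<omega>. complex_of_real (indicator {\<omega> \<in> space M. U \<omega> = 1} \<omega>))"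
      by (intro Bochner_Integration.integral_cong refl) (auto simp: e1_def indicator_def)
    then show ?thesis by (simp add: U1 del: of_real_indicator)
  qed
  have U01: "AE \<omega> in M. U \<omega> = 0 \<or> U \<omega> = 1"
  proof -
    have "prob ({\<omega> \<in> space M. U \<omega> = 0} \<union> {\<omega> \<in> space M. U \<omega> = 1})
        = prob {\<omega> \<in> space M. U \<omega> = 0} + prob {\<omega> \<in> space M. U \<omega> = 1}"
      by (rule finite_measure_Union) auto
    also have "\<dots> = 1" by (simp add: U0 U1)
    also have "{\<omega> \<in> space M. U \<omega> = 0} \<union> {\<omega> \<in> space M. U \<omega> = 1}
        = {\<omega> \<in> space M. U \<omega> = 0 \<or> U \<omega> = 1}" by auto
    finally show ?thesis by (subst (asm) prob_Collect_eq_1) auto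
  qed
  have EV: "expectation (\<lambda>\<omega>. iexp (t * V \<omega>)) = fourier f t"
  proof -
    have [measurable]: "f \<in> borel_measurable lborel"
      using distributed_real_measurable[OF _ f(2)] f(1) by simp
    have "expectation (\<lambda>\<omega>. iexp (t * V \<omega>)) = (\<integral>x. iexp (t * x) \<partial>distr M lborel V)"
      by (subst integral_distr) auto
    also have "distr M lborel V = density lborel (\<lambda>x. ennreal (f x))"
      by (rule distributed_distr_eq_density[OF f(2)])
    also have "(\<integral>x. iexp (t * x) \<partial>density lborel (\<lambda>x. ennreal (f x))) = fourier f t"
      unfolding fourier_def using f(1)
      by (subst integral_density) (auto simp: scaleR_conv_of_real mult.commute)
    finally show ?thesis .
  qed
  have EZ: "expectation (\<lambda>\<omega>. iexp (t * (\<sigma> * Z \<omega>))) = complex_of_real (exp (- (\<sigma>\<^sup>2 * t\<^sup>2 / 2)))"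
  proof -
    have "expectation (\<lambda>\<omega>. iexp (t * (\<sigma> * Z \<omega>))) = (\<integral>x. iexp ((t * \<sigma>) * x) \<partial>distr M lborel Z)"
      by (subst integral_distr) (auto simp: mult.assoc)
    also have "distr M lborel Z = density lborel (\<lambda>x. ennreal (std_normal_density x))"
      by (rule distributed_distr_eq_density[OF Z])
    also have "(\<integral>x. iexp ((t * \<sigma>) * x) \<partial>density lborel (\<lambda>x. ennreal (std_normal_density x)))
        = char std_normal_distribution (t * \<sigma>)"
      by (simp add: char_def)
    finally show ?thesis
      by (simp add: char_std_normal_distribution power_mult_distrib mult.commute)
  qed
  have "expectation (\<lambda>\<omega>. iexp (t * (U \<omega> * V \<omega> + \<sigma> * Z \<omega>)))
      = expectation (\<lambda>\<omega>. e0 (U \<omega>) * (1 * iexp (t * (\<sigma> * Z \<omega>)))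
          + e1 (U \<omega>) * (iexp (t * V \<omega>) * iexp (t * (\<sigma> * Z \<omega>))))"
  proof (rule integral_cong_AE)
    show "AE \<omega> in M. iexp (t * (U \<omega> * V \<omega> + \<sigma> * Z \<omega>))
        = e0 (U \<omega>) * (1 * iexp (t * (\<sigma> * Z \<omega>))) + e1 (U \<omega>) * (iexp (t * V \<omega>) * iexp (t * (\<sigma> * Z \<omega>)))"
      using U01 by eventually_elim
        (auto simp: e0_def e1_def distrib_left exp_add)
  qed measurable
  also have "\<dots> = expectation (\<lambda>\<omega>. e0 (U \<omega>) * (1 * iexp (t * (\<sigma> * Z \<omega>))))
      + expectation (\<lambda>\<omega>. e1 (U \<omega>) * (iexp (t * V \<omega>) * iexp (t * (\<sigma> * Z \<omega>))))"
    by (intro Bochner_Integration.integral_add integrable_const_bound[of _ 1])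
       (auto simp: norm_mult e_le)
  also have "expectation (\<lambda>\<omega>. e0 (U \<omega>) * (1 * iexp (t * (\<sigma> * Z \<omega>))))
      = complex_of_real p * (1 * complex_of_real (exp (- (\<sigma>\<^sup>2 * t\<^sup>2 / 2))))"
    by (subst split[of e0 "\<lambda>_. 1" "\<lambda>z. iexp (t * (\<sigma> * z))"]) (simp_all add: e_le Ee0 EZ[simplified] prob_space)
  also have "expectation (\<lambda>\<omega>. e1 (U \<omega>) * (iexp (t * V \<omega>) * iexp (t * (\<sigma> * Z \<omega>))))
      = complex_of_real (1 - p) * (fourier f t * complex_of_real (exp (- (\<sigma>\<^sup>2 * t\<^sup>2 / 2))))"
    by (subst split[of e1 "\<lambda>v. iexp (t * v)" "\<lambda>z. iexp (t * (\<sigma> * z))"]) (simp_all add: e_le Ee1 EV[simplified] EZ[simplified])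
  finally show ?thesis by (simp add: algebra_simps)
qed

section \<open>The estimator as a sample mean\<close>

text \<open>
  The estimator computed from the single observation \<open>x\<close>.
\<close>

definition deconv_summand :: "real \<Rightarrow> (real \<Rightarrow> complex) \<Rightarrow> real \<Rightarrow> real \<Rightarrow> complex" where
  "deconv_summand \<sigma> \<phi> g x =
     complex_of_real (g / 2) *
     (CLBINT t:{- (1 / g)..1 / g}.
        iexp (t * x) * \<phi> (g * t) / complex_of_real (exp (- (\<sigma>\<^sup>2 * t\<^sup>2 / 2))))"

lemma borel_measurable_deconv_summand:
  assumes [measurable]: "\<phi> \<in> borel_measurable borel"
  shows "deconv_summand \<sigma> \<phi> g \<in> borel_measurable borel"
  unfolding deconv_summand_def set_lebesgue_integral_def by measurable

lemma set_integrable_deconv_integrand: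
  fixes \<phi> :: "real \<Rightarrow> complex"
  assumes [measurable]: "\<phi> \<in> borel_measurable borel" and bdd: "\<And>t. cmod (\<phi> t) \<le> K"
  shows "set_integrable lborel {a..b}
           (\<lambda>t. iexp (t * x) * \<phi> (g * t) / complex_of_real (exp (- (\<sigma>\<^sup>2 * t\<^sup>2 / 2))))"
proof (rule set_integrable_bound)
  show "set_integrable lborel {a..b} (\<lambda>t. K * exp (\<sigma>\<^sup>2 * t\<^sup>2 / 2))"
    by (intro borel_integrable_atLeastAtMost' continuous_intros) auto
  show "AE t in lborel. t \<in> {a..b} \<longrightarrow>
      norm (iexp (t * x) * \<phi> (g * t) / complex_of_real (exp (- (\<sigma>\<^sup>2 * t\<^sup>2 / 2))))
      \<le> norm (K * exp (\<sigma>\<^sup>2 * t\<^sup>2 / 2))"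
  proof (intro always_eventually allI impI)
    fix t
    have "norm (iexp (t * x) * \<phi> (g * t) / complex_of_real (exp (- (\<sigma>\<^sup>2 * t\<^sup>2 / 2))))
        = cmod (\<phi> (g * t)) / exp (- (\<sigma>\<^sup>2 * t\<^sup>2 / 2))"
      by (simp only: norm_mult norm_divide norm_exp_i_times norm_of_real abs_exp_cancel mult_1)
    also have "\<dots> = cmod (\<phi> (g * t)) * exp (\<sigma>\<^sup>2 * t\<^sup>2 / 2)"
      by (simp only: exp_minus divide_inverse inverse_inverse_eq)
    also have "\<dots> \<le> \<bar>K\<bar> * exp (\<sigma>\<^sup>2 * t\<^sup>2 / 2)"
      by (intro mult_right_mono order_trans[OF bdd abs_ge_self]) (simp only: exp_ge_zero)
    also have "\<dots> = norm (K * exp (\<sigma>\<^sup>2 * t\<^sup>2 / 2))"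
      by (simp only: real_norm_def abs_mult abs_exp_cancel)
    finally show "norm (iexp (t * x) * \<phi> (g * t) / complex_of_real (exp (- (\<sigma>\<^sup>2 * t\<^sup>2 / 2))))
        \<le> norm (K * exp (\<sigma>\<^sup>2 * t\<^sup>2 / 2))" .
  qed
qed (unfold set_borel_measurable_def, measurable)

text \<open>
  The empirical characteristic function enters the estimator linearly.  For independent, identically
  distributed observations the estimator is thus an average of independent copies of one variable.
\<close>

lemma p_ng_sample_mean:
  assumes "\<phi> \<in> borel_measurable borel" and "\<And>t. cmod (\<phi> t) \<le> K"
  shows "p_ng \<sigma> \<phi> X n g \<omega> = (\<Sum>j<n. deconv_summand \<sigma> \<phi> g (X j \<omega>)) / of_nat n"
proof -
  define J where "J = {- (1 / g)..1 / g}"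
  define w where "w = (\<lambda>x t. iexp (t * x) * \<phi> (g * t) / complex_of_real (exp (- (\<sigma>\<^sup>2 * t\<^sup>2 / 2))))"
  have int: "integrable lborel (\<lambda>t. indicator J t *\<^sub>R w x t)" for x
    using set_integrable_deconv_integrand[OF assms] by (simp add: set_integrable_def J_def w_def)
  define I where "I = (\<lambda>x. CLBINT t. indicator J t *\<^sub>R w x t)"
  have p_ng_eq: "p_ng \<sigma> \<phi> X n g \<omega> = complex_of_real (g / 2) *
      (CLBINT t. (1 / of_nat n) * (\<Sum>j<n. indicator J t *\<^sub>R w (X j \<omega>) t))"
    unfolding p_ng_def phi_emp_def set_lebesgue_integral_def J_def[symmetric]
  proof (intro arg_cong2[where f = "(*)"] refl Bochner_Integration.integral_cong)
    fix t
    show "indicator J t *\<^sub>R ((1 / of_nat n) * (\<Sum>j<n. iexp (t * X j \<omega>)) * \<phi> (g * t)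
            / complex_of_real (exp (- (\<sigma>\<^sup>2 * t\<^sup>2 / 2))))
        = (1 / of_nat n) * (\<Sum>j<n. indicator J t *\<^sub>R w (X j \<omega>) t)"
      by (cases "t \<in> J") (simp_all add: w_def flip: sum_distrib_right sum_divide_distrib)
  qed
  have sum_eq: "(CLBINT t. (1 / of_nat n) * (\<Sum>j<n. indicator J t *\<^sub>R w (X j \<omega>) t))
      = (1 / of_nat n) * (\<Sum>j<n. I (X j \<omega>))"
    unfolding I_def
    by (subst integral_mult_right_zero, subst Bochner_Integration.integral_sum) (use int in auto)
  have summand_eq: "deconv_summand \<sigma> \<phi> g x = complex_of_real (g / 2) * I x" for x
    by (simp add: deconv_summand_def set_lebesgue_integral_def I_def J_def w_def)
  show ?thesis
    unfolding p_ng_eq sum_eq summand_eq sum_distrib_left[symmetric]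
    by (simp only: divide_inverse mult_1_left ac_simps)
qed

text \<open>
  Because \<open>iexp\<close> has modulus one, a single bound serves all \<open>x\<close>.  After the substitution \<open>s = g t\<close> it is
  the endpoint integral with \<open>l = \<sigma>\<^sup>2 / (2 g\<^sup>2)\<close>, and \<open>l powr (- (\<alpha> + 1))\<close> is a multiple of
  \<open>g powr (2 + 2 \<alpha>)\<close>.  The square of the bound, divided by \<open>n\<close>, is the variance term of the rate.
\<close>

lemma deconv_summand_bound:
  assumes [measurable]: "\<phi> \<in> borel_measurable borel" and bdd: "\<And>t. cmod (\<phi> t) \<le> K"
    and env: "AE s in lborel. \<bar>s\<bar> \<le> 1 \<longrightarrow> cmod (\<phi> s) \<le> C * (1 - \<bar>s\<bar>) powr \<alpha>"
    and "0 \<le> C" "0 \<le> \<alpha>" "0 < \<sigma>" "0 < g"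
  shows "cmod (deconv_summand \<sigma> \<phi> g x)
       \<le> C * Gamma (\<alpha> + 1) * (2 / \<sigma>\<^sup>2) powr (\<alpha> + 1) * (g powr (2 + 2 * \<alpha>) * exp (\<sigma>\<^sup>2 / (2 * g\<^sup>2)))"
proof -
  define l where "l = \<sigma>\<^sup>2 / (2 * g\<^sup>2)"
  have l: "0 < l" using assms by (simp add: l_def)
  define J where "J = {- (1 / g)..1 / g}"
  define w where "w = (\<lambda>t. iexp (t * x) * \<phi> (g * t) / complex_of_real (exp (- (\<sigma>\<^sup>2 * t\<^sup>2 / 2))))"
  define q where "q = (\<lambda>s. ennreal (indicator {-1..1} s * (cmod (\<phi> s) * exp (l * s\<^sup>2))))"
  have [measurable]: "q \<in> borel_measurable borel" unfolding q_def by measurable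
  have int: "integrable lborel (\<lambda>t. indicator J t *\<^sub>R w t)"
    using set_integrable_deconv_integrand[OF assms(1,2)] by (simp add: set_integrable_def J_def w_def)
  have norm_w: "ennreal (norm (indicator J t *\<^sub>R w t)) = q (0 + g * t)" for t
  proof -
    have "t \<in> J \<longleftrightarrow> g * t \<in> {-1..1}"
      using \<open>0 < g\<close> by (auto simp: J_def field_simps)
    moreover have eq: "l * (g * t)\<^sup>2 = \<sigma>\<^sup>2 * t\<^sup>2 / 2"
      using \<open>0 < g\<close> by (simp add: l_def power_mult_distrib)
    moreover have "cmod (w t) = cmod (\<phi> (g * t)) * exp (l * (g * t)\<^sup>2)"
    proof -
      have "cmod (w t) = cmod (\<phi> (g * t)) / exp (- (l * (g * t)\<^sup>2))"
        unfolding w_def eq by (simp only: norm_mult norm_divide norm_exp_i_times norm_of_real abs_exp_cancel mult_1)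
      then show ?thesis by (simp only: exp_minus divide_inverse inverse_inverse_eq)
    qed
    ultimately show ?thesis
      unfolding q_def by (cases "t \<in> J") simp_all
  qed
  define G where "G = exp l * Gamma (\<alpha> + 1) * l powr (- (\<alpha> + 1))"
  have "0 < Gamma (\<alpha> + 1)" using \<open>0 \<le> \<alpha>\<close> by (intro Gamma_real_pos) simp
  then have G: "0 \<le> G" by (simp add: G_def)
  have "(\<integral>\<^sup>+ s. q s \<partial>lborel)
      \<le> (\<integral>\<^sup>+ s. ennreal C * ennreal (indicator {-1..1} s * (1 - \<bar>s\<bar>) powr \<alpha> * exp (l * s\<^sup>2)) \<partial>lborel)"
  proof (rule nn_integral_mono_AE)
    show "AE s in lborel. q s
        \<le> ennreal C * ennreal (indicator {-1..1} s * (1 - \<bar>s\<bar>) powr \<alpha> * exp (l * s\<^sup>2))"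
      using env
    proof eventually_elim
      case (elim s)
      show ?case
      proof (cases "\<bar>s\<bar> \<le> 1")
        case True
        then have "cmod (\<phi> s) * exp (l * s\<^sup>2) \<le> C * (1 - \<bar>s\<bar>) powr \<alpha> * exp (l * s\<^sup>2)"
          using elim by (intro mult_right_mono) auto
        then show ?thesis using True \<open>0 \<le> C\<close>
          by (auto simp: q_def abs_le_iff mult.assoc simp flip: ennreal_mult')
      qed (auto simp: q_def indicator_def)
    qed
  qed
  also have "\<dots> = ennreal C * (\<integral>\<^sup>+ s. ennreal (indicator {-1..1} s * (1 - \<bar>s\<bar>) powr \<alpha> * exp (l * s\<^sup>2)) \<partial>lborel)"
    by (rule nn_integral_cmult) measurable
  also have "\<dots> \<le> ennreal C * ennreal (2 * exp l * Gamma (\<alpha> + 1) * l powr (- (\<alpha> + 1)))"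
    by (intro mult_left_mono nn_integral_endpoint_exp assms l) auto
  also have "\<dots> = ennreal (C * (2 * G))"
    unfolding ennreal_mult'[OF \<open>0 \<le> C\<close>, symmetric] G_def by (simp only: mult.assoc)
  finally have q_int: "(\<integral>\<^sup>+ s. q s \<partial>lborel) \<le> ennreal (C * (2 * G))" .
  have "ennreal (cmod (deconv_summand \<sigma> \<phi> g x))
      = ennreal (g / 2) * ennreal (norm (CLBINT t. indicator J t *\<^sub>R w t))"
    using \<open>0 < g\<close> by (simp add: deconv_summand_def set_lebesgue_integral_def J_def w_def norm_mult
        flip: ennreal_mult')
  also have "\<dots> \<le> ennreal (g / 2) * (\<integral>\<^sup>+ t. q (0 + g * t) \<partial>lborel)"
    using integral_norm_bound_ennreal[OF int] unfolding norm_w by (intro mult_left_mono) auto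
  also have "\<dots> = ennreal (1 / 2) * (ennreal \<bar>g\<bar> * (\<integral>\<^sup>+ t. q (0 + g * t) \<partial>lborel))"
  proof -
    have "ennreal (g / 2) = ennreal (1 / 2) * ennreal \<bar>g\<bar>"
      using \<open>0 < g\<close> by (subst ennreal_mult'[symmetric]) auto
    then show ?thesis by (simp only: mult.assoc)
  qed
  also have "ennreal \<bar>g\<bar> * (\<integral>\<^sup>+ t. q (0 + g * t) \<partial>lborel) = (\<integral>\<^sup>+ s. q s \<partial>lborel)"
    using \<open>0 < g\<close> by (subst nn_integral_real_affine[of q g 0]) auto
  also have "ennreal (1 / 2) * (\<integral>\<^sup>+ s. q s \<partial>lborel) \<le> ennreal (1 / 2) * ennreal (C * (2 * G))"
    by (intro mult_left_mono q_int) simp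
  also have "\<dots> = ennreal (1 / 2 * (C * (2 * G)))"
    by (rule ennreal_mult'[symmetric]) simp
  finally have "cmod (deconv_summand \<sigma> \<phi> g x) \<le> 1 / 2 * (C * (2 * G))"
    by (rule ennreal_le_iff[THEN iffD1, rotated]) (use \<open>0 \<le> C\<close> G in simp)
  also have "1 / 2 * (C * (2 * G)) = C * G" by simp
  finally have bound: "cmod (deconv_summand \<sigma> \<phi> g x) \<le> C * G" .
  have l_powr: "l powr (- (\<alpha> + 1)) = (2 / \<sigma>\<^sup>2) powr (\<alpha> + 1) * g powr (2 + 2 * \<alpha>)"
  proof -
    have g2: "g\<^sup>2 = g powr 2"
      using \<open>0 < g\<close> by (simp only: powr_numeral)
    have "l powr (- (\<alpha> + 1)) = inverse (l powr (\<alpha> + 1))"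
      by (rule powr_minus)
    also have "\<dots> = inverse l powr (\<alpha> + 1)"
      by (rule inverse_powr[symmetric])
    also have "inverse l = 2 / \<sigma>\<^sup>2 * g powr 2"
      unfolding l_def g2[symmetric] by (simp only: inverse_divide times_divide_eq_left)
    also have "(2 / \<sigma>\<^sup>2 * g powr 2) powr (\<alpha> + 1) = (2 / \<sigma>\<^sup>2) powr (\<alpha> + 1) * g powr (2 * (\<alpha> + 1))"
      by (subst powr_mult, subst powr_powr) (rule refl)
    also have "2 * (\<alpha> + 1) = 2 + 2 * \<alpha>" by (rule trans[OF distrib_left]) (simp only: mult_1_right add.commute)
    finally show ?thesis .
  qed
  have reorder: "C * (a * b * (c * d)) = C * b * c * (d * a)" for a b c d :: real
    by (simp only: ac_simps)
  have "C * G = C * Gamma (\<alpha> + 1) * (2 / \<sigma>\<^sup>2) powr (\<alpha> + 1) * (g powr (2 + 2 * \<alpha>) * exp l)"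
    unfolding G_def l_powr by (rule reorder)
  with bound show ?thesis unfolding l_def by (rule ord_le_eq_trans)
qed

text \<open>
  Fubini: the modulus of the integrand does not depend on \<open>x\<close>, and \<open>P\<close> is a finite measure.
\<close>

lemma integral_deconv_summand:
  fixes P :: "real measure"
  assumes "prob_space P" and [measurable_cong]: "sets P = sets borel"
    and [measurable]: "\<phi> \<in> borel_measurable borel" and bdd: "\<And>t. cmod (\<phi> t) \<le> K"
  shows "(\<integral>x. deconv_summand \<sigma> \<phi> g x \<partial>P) = complex_of_real (g / 2) *
    (CLBINT t:{- (1 / g)..1 / g}. char P t * \<phi> (g * t) / complex_of_real (exp (- (\<sigma>\<^sup>2 * t\<^sup>2 / 2))))"
proof -
  interpret P: prob_space P by fact
  interpret PL: pair_sigma_finite P lborel ..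
  define J where "J = {- (1 / g)..1 / g}"
  define v where "v = (\<lambda>t. indicator J t *\<^sub>R (\<phi> (g * t) / complex_of_real (exp (- (\<sigma>\<^sup>2 * t\<^sup>2 / 2)))))"
  have v_int: "integrable lborel v"
    using set_integrable_deconv_integrand[OF assms(3,4), where x = 0]
    by (simp add: set_integrable_def J_def v_def)
  then have [measurable]: "v \<in> borel_measurable borel" by simp
  have J_v: "indicator J t *\<^sub>R (z * \<phi> (g * t) / complex_of_real (exp (- (\<sigma>\<^sup>2 * t\<^sup>2 / 2)))) = z * v t"
    for z t by (simp add: v_def)
  have "integrable (P \<Otimes>\<^sub>M lborel) (\<lambda>(x, t). iexp (t * x) * v t)"
  proof (rule PL.Fubini_integrable)
    show "(\<lambda>(x, t). iexp (t * x) * v t) \<in> borel_measurable (P \<Otimes>\<^sub>M lborel)"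
      by measurable
    show "integrable P (\<lambda>x. \<integral>t. norm (case (x, t) of (x, t) \<Rightarrow> iexp (t * x) * v t) \<partial>lborel)"
      by (simp add: norm_mult)
    show "AE x in P. integrable lborel (\<lambda>t. case (x, t) of (x, t) \<Rightarrow> iexp (t * x) * v t)"
      using set_integrable_deconv_integrand[OF assms(3,4), of "- (1 / g)" "1 / g" _ g \<sigma>]
      unfolding set_integrable_def J_def[symmetric] J_v by simp
  qed
  then have "(\<integral>x. (\<integral>t. iexp (t * x) * v t \<partial>lborel) \<partial>P) = (\<integral>t. (\<integral>x. iexp (t * x) * v t \<partial>P) \<partial>lborel)"
    by (rule PL.Fubini_integral[symmetric])
  then show ?thesis
    unfolding deconv_summand_def set_lebesgue_integral_def J_def[symmetric] J_v char_def by simp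
qed

text \<open>
  Dividing by the Gaussian factor leaves \<open>p + (1 - p) F(t)\<close> in the mean of a summand.  The constant part
  contributes exactly \<open>p\<close>, because \<open>\<phi>\<close> integrates to two; the bias is therefore
  \<open>(1 - p) (g/2) \<integral> F(t) \<phi>(g t) dt\<close>.  The factor \<open>g/2\<close> gives one power of \<open>g\<close>, and a zero of order \<open>\<delta>\<close> of
  \<open>\<phi>\<close> at the origin gives \<open>\<delta>\<close> more.  The case \<open>\<delta> = 0\<close>, where the bound on \<open>\<phi>\<close> is mere boundedness, yields
  consistency; \<open>\<delta> = \<gamma>\<close> yields the rate.
\<close>

lemma deconv_bias_bound:
  fixes P :: "real measure" and F :: "real \<Rightarrow> complex"
  assumes "prob_space P" "sets P = sets borel"
    and [measurable]: "\<phi> \<in> borel_measurable borel" and bdd: "\<And>t. cmod (\<phi> t) \<le> K"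
    and supp: "supported_in_unit_interval \<phi>" and two: "integrates_to_two \<phi>"
    and char: "\<And>t. char P t = (complex_of_real p + complex_of_real (1 - p) * F t)
        * complex_of_real (exp (- (\<sigma>\<^sup>2 * t\<^sup>2 / 2)))"
    and p: "0 \<le> p" "p \<le> 1"
    and F: "integrable lborel F"
    and F\<delta>: "integrable lborel (\<lambda>t. complex_of_real (\<bar>t\<bar> powr \<delta>) * F t)"
    and \<phi>_le: "\<And>s. s \<noteq> 0 \<Longrightarrow> cmod (\<phi> s) \<le> C * \<bar>s\<bar> powr \<delta>" and "0 < g"
  shows "cmod ((\<integral>x. deconv_summand \<sigma> \<phi> g x \<partial>P) - complex_of_real p)
       \<le> C / 2 * (\<integral>t. cmod (complex_of_real (\<bar>t\<bar> powr \<delta>) * F t) \<partial>lborel) * g powr (1 + \<delta>)"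
proof -
  define J where "J = {- (1 / g)..1 / g}"
  have [measurable]: "F \<in> borel_measurable borel" using F by simp
  have \<phi>_int: "integrable lborel \<phi>"
    using two not_integrable_integral_eq[of lborel \<phi>] by (auto simp: integrates_to_two_def)
  have \<phi>g_int: "integrable lborel (\<lambda>t. \<phi> (g * t))"
    using lborel_integrable_real_affine[OF \<phi>_int, of g 0] \<open>0 < g\<close> by simp
  have \<phi>g: "complex_of_real (g / 2) * (CLBINT t. \<phi> (g * t)) = 1"
    using lborel_integral_real_affine[of g \<phi> 0] \<open>0 < g\<close> two
    by (simp add: integrates_to_two_def scaleR_conv_of_real)
  have outside: "\<phi> (g * t) = 0" if "t \<notin> J" for t
  proof -
    have "g * t \<notin> {-1..1}" using that \<open>0 < g\<close> by (auto simp: J_def field_simps)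
    then show ?thesis using supp by (simp add: supported_in_unit_interval_def)
  qed
  have F\<phi>_int: "integrable lborel (\<lambda>t. F t * \<phi> (g * t))"
  proof (rule Bochner_Integration.integrable_bound)
    show "integrable lborel (\<lambda>t. K * cmod (F t))" using F by simp
    show "AE t in lborel. norm (F t * \<phi> (g * t)) \<le> norm (K * cmod (F t))"
    proof (intro always_eventually allI)
      fix t
      have "cmod (\<phi> (g * t)) \<le> \<bar>K\<bar>" using bdd[of "g * t"] by simp
      then show "norm (F t * \<phi> (g * t)) \<le> norm (K * cmod (F t))"
        by (simp add: norm_mult abs_mult mult.commute[of "\<bar>K\<bar>"] mult_left_mono)
    qed
  qed measurable
  have "(\<integral>x. deconv_summand \<sigma> \<phi> g x \<partial>P)
      = complex_of_real (g / 2) * (CLBINT t. complex_of_real p * \<phi> (g * t) + complex_of_real (1 - p) * (F t * \<phi> (g * t)))"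
    unfolding integral_deconv_summand[OF assms(1-4)] set_lebesgue_integral_def J_def[symmetric] char
  proof (intro arg_cong2[where f = "(*)"] refl Bochner_Integration.integral_cong)
    fix t
    have cancel: "z * e * y / e = z * y" if "e \<noteq> 0" for z e y :: complex
      using that by simp
    have "exp (- (\<sigma>\<^sup>2 * t\<^sup>2 / 2)) \<noteq> 0" by simp
    then have "complex_of_real (exp (- (\<sigma>\<^sup>2 * t\<^sup>2 / 2))) \<noteq> 0"
      by (simp only: of_real_eq_0_iff not_False_eq_True)
    note cancel = cancel[OF this]
    show "indicator J t *\<^sub>R ((complex_of_real p + complex_of_real (1 - p) * F t)
            * complex_of_real (exp (- (\<sigma>\<^sup>2 * t\<^sup>2 / 2))) * \<phi> (g * t)
            / complex_of_real (exp (- (\<sigma>\<^sup>2 * t\<^sup>2 / 2))))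
        = complex_of_real p * \<phi> (g * t) + complex_of_real (1 - p) * (F t * \<phi> (g * t))"
      unfolding cancel
      by (cases "t \<in> J") (simp_all add: outside distrib_right mult.assoc del: of_real_diff)
  qed
  also have "\<dots> = complex_of_real p * (complex_of_real (g / 2) * (CLBINT t. \<phi> (g * t)))
      + complex_of_real (1 - p) * complex_of_real (g / 2) * (CLBINT t. F t * \<phi> (g * t))"
  proof -
    have "integrable lborel (\<lambda>t. complex_of_real p * \<phi> (g * t))"
      by (rule integrable_mult_right) (rule \<phi>g_int)
    moreover have "integrable lborel (\<lambda>t. complex_of_real (1 - p) * (F t * \<phi> (g * t)))"
      by (rule integrable_mult_right) (rule F\<phi>_int)
    ultimately show ?thesis
      by (simp only: Bochner_Integration.integral_add integral_mult_right_zero)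
         (simp only: distrib_left mult.left_commute mult.assoc)
  qed
  finally have "(\<integral>x. deconv_summand \<sigma> \<phi> g x \<partial>P) - complex_of_real p
      = complex_of_real ((1 - p) * (g / 2)) * (CLBINT t. F t * \<phi> (g * t))"
    unfolding \<phi>g by (simp only: of_real_mult mult_1_right add_diff_cancel_left')
  then have "cmod ((\<integral>x. deconv_summand \<sigma> \<phi> g x \<partial>P) - complex_of_real p)
      = (1 - p) * (g / 2) * cmod (CLBINT t. F t * \<phi> (g * t))"
    using p \<open>0 < g\<close> by (simp only: norm_mult norm_of_real) simp
  also have "\<dots> \<le> 1 * (g / 2) * cmod (CLBINT t. F t * \<phi> (g * t))"
    using p \<open>0 < g\<close> by (intro mult_right_mono) auto
  also have "\<dots> \<le> 1 * (g / 2) * (\<integral>t. C * g powr \<delta> * cmod (complex_of_real (\<bar>t\<bar> powr \<delta>) * F t) \<partial>lborel)"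
  proof (intro mult_left_mono)
    have "cmod (CLBINT t. F t * \<phi> (g * t)) \<le> (\<integral>t. cmod (F t * \<phi> (g * t)) \<partial>lborel)"
      by (rule integral_norm_bound)
    also have "\<dots> \<le> (\<integral>t. C * g powr \<delta> * cmod (complex_of_real (\<bar>t\<bar> powr \<delta>) * F t) \<partial>lborel)"
    proof (rule integral_mono_AE)
      show "AE t in lborel. cmod (F t * \<phi> (g * t))
          \<le> C * g powr \<delta> * cmod (complex_of_real (\<bar>t\<bar> powr \<delta>) * F t)"
        using AE_lborel_singleton[of "0::real"]
      proof eventually_elim
        case (elim t)
        have "cmod (\<phi> (g * t)) \<le> C * \<bar>g * t\<bar> powr \<delta>"
          using elim \<open>0 < g\<close> by (intro \<phi>_le) auto
        also have "\<bar>g * t\<bar> powr \<delta> = g powr \<delta> * \<bar>t\<bar> powr \<delta>"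
          using \<open>0 < g\<close> by (simp add: abs_mult powr_mult)
        finally have "cmod (F t) * cmod (\<phi> (g * t)) \<le> cmod (F t) * (C * (g powr \<delta> * \<bar>t\<bar> powr \<delta>))"
          by (rule mult_left_mono) simp
        then show ?case by (simp add: norm_mult ac_simps)
      qed
    qed (use F\<phi>_int F\<delta> in auto)
    finally show "cmod (CLBINT t. F t * \<phi> (g * t))
        \<le> (\<integral>t. C * g powr \<delta> * cmod (complex_of_real (\<bar>t\<bar> powr \<delta>) * F t) \<partial>lborel)" .
  qed (use \<open>0 < g\<close> in simp)
  finally show ?thesis
    using \<open>0 < g\<close> by (simp add: powr_add ac_simps)
qed

section \<open>Consistency and rate\<close>

theorem theorem2p3:
  fixes \<sigma> p \<alpha> \<gamma> K :: real
    and M :: "'a measure" and U V Z X :: "'a \<Rightarrow> real" and f :: "real \<Rightarrow> real"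
    and N :: "'b measure" and Xs :: "nat \<Rightarrow> 'b \<Rightarrow> real"
    and k :: "real \<Rightarrow> real" and \<phi>\<^sub>k :: "real \<Rightarrow> complex"
    and g :: "nat \<Rightarrow> real"
  assumes "\<sigma> > 0" and "0 \<le> p" and "p < 1" and "\<alpha> \<ge> 0" and "\<gamma> > 0"
    and "prob_space M"
    and "prob_space.indep_vars M (\<lambda>_. borel) (\<lambda>i. [U, V, Z] ! i) {..<3}"
    and "measure M {\<omega> \<in> space M. U \<omega> = 0} = p"
    and "measure M {\<omega> \<in> space M. U \<omega> = 1} = 1 - p"
    and "\<And>x. f x \<ge> 0"
    and "distributed M lborel V (\<lambda>x. ennreal (f x))"
    and "distributed M lborel Z (\<lambda>x. ennreal (std_normal_density x))"
    and "\<And>\<omega>. X \<omega> = U \<omega> * V \<omega> + \<sigma> * Z \<omega>"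
    and "prob_space N"
    and "prob_space.indep_vars N (\<lambda>_. borel) Xs UNIV"
    and "\<And>j. distr N borel (Xs j) = distr M borel X"
    and "integrable lborel (fourier f)"
    and "integrable M (\<lambda>\<omega>. (X \<omega>)\<^sup>2)"
    and "has_fourier_transform k \<phi>\<^sub>k"
    and "supported_in_unit_interval \<phi>\<^sub>k"
    and "\<And>t. cmod (\<phi>\<^sub>k t) \<le> K"
    and "integrates_to_two \<phi>\<^sub>k"
    and "\<And>n. g n > 0" and "g \<longlonglongrightarrow> 0"
  shows "(endpoint_exponent \<phi>\<^sub>k \<alpha> \<longrightarrow>
           (\<lambda>n. g n powr (4 + 4 * \<alpha>) * exp (\<sigma>\<^sup>2 / (g n)\<^sup>2) / real n) \<longlonglongrightarrow> 0 \<longrightarrow>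
           (\<forall>\<epsilon>>0. (\<lambda>n. measure N {\<omega> \<in> space N.
                     cmod (p_ng \<sigma> \<phi>\<^sub>k Xs n (g n) \<omega> - complex_of_real p) > \<epsilon>}) \<longlonglongrightarrow> 0))
       \<and> (condition_F f \<gamma> \<longrightarrow> condition_K \<phi>\<^sub>k \<alpha> \<gamma> \<longrightarrow>
           (\<lambda>n. \<integral>\<omega>. (cmod (p_ng \<sigma> \<phi>\<^sub>k Xs n (g n) \<omega> - complex_of_real p))\<^sup>2 \<partial>N)
             \<in> O(\<lambda>n. g n powr (2 + 2 * \<gamma>) + g n powr (4 + 4 * \<alpha>) * exp (\<sigma>\<^sup>2 / (g n)\<^sup>2) / real n))"
proof -
  note \<sigma> = \<open>\<sigma> > 0\<close> and p = \<open>0 \<le> p\<close> \<open>p < 1\<close>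
  note \<phi>_bdd = \<open>\<And>t. cmod (\<phi>\<^sub>k t) \<le> K\<close> and g_pos = \<open>\<And>n. g n > 0\<close>
  have \<phi>_meas [measurable]: "\<phi>\<^sub>k \<in> borel_measurable borel"
    using \<open>has_fourier_transform k \<phi>\<^sub>k\<close> by (simp add: has_fourier_transform_def)
  have hermitian: "AE t in lborel. \<phi>\<^sub>k (- t) = cnj (\<phi>\<^sub>k t)"
    by (rule fourier_transform_hermitian) fact
  interpret M: prob_space M by fact
  interpret N: prob_space N by fact
  define P where "P = distr M borel X"
  have UVZ: "([U, V, Z] ! i) \<in> borel_measurable M" if "i < 3" for i
    using assms(7) that by (simp add: M.indep_vars_def)
  have [measurable]: "U \<in> borel_measurable M" "V \<in> borel_measurable M" "Z \<in> borel_measurable M"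
    using UVZ[of 0] UVZ[of 1] UVZ[of 2] by (simp_all add: numeral_2_eq_2)
  have X: "X = (\<lambda>\<omega>. U \<omega> * V \<omega> + \<sigma> * Z \<omega>)"
    using assms(13) by (rule ext)
  have [measurable]: "X \<in> borel_measurable M" unfolding X by measurable
  have P: "prob_space P" "sets P = sets borel"
    by (auto simp: P_def intro: M.prob_space_distr)
  have char_P: "char P t = (complex_of_real p + complex_of_real (1 - p) * fourier f t)
      * complex_of_real (exp (- (\<sigma>\<^sup>2 * t\<^sup>2 / 2)))" for t
  proof -
    have "char P t = M.expectation (\<lambda>\<omega>. iexp (t * (U \<omega> * V \<omega> + \<sigma> * Z \<omega>)))"
      unfolding char_def P_def by (subst integral_distr) (auto simp: X)
    then show ?thesis
      using M.characteristic_function_mixture[OF assms(7-12)] by simp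
  qed
  have Xs [measurable]: "Xs j \<in> borel_measurable N" for j
    using assms(15) by (simp add: N.indep_vars_def)
  define h where "h = (\<lambda>n. deconv_summand \<sigma> \<phi>\<^sub>k (g n))"
  have [measurable]: "h n \<in> borel_measurable borel" for n
    unfolding h_def by (rule borel_measurable_deconv_summand) measurable
  have p_ng_eq: "p_ng \<sigma> \<phi>\<^sub>k Xs n (g n) \<omega> = (\<Sum>j<n. h n (Xs j \<omega>)) / of_nat n" for n \<omega>
    unfolding h_def by (rule p_ng_sample_mean[OF \<phi>_meas \<phi>_bdd])
  define mse where "mse = (\<lambda>n. \<integral>\<omega>. (cmod (p_ng \<sigma> \<phi>\<^sub>k Xs n (g n) \<omega> - complex_of_real p))\<^sup>2 \<partial>N)"
  define v where "v = (\<lambda>n. g n powr (4 + 4 * \<alpha>) * exp (\<sigma>\<^sup>2 / (g n)\<^sup>2) / real n)"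

  have h_bound: "\<exists>D. \<forall>n x. cmod (h n x) \<le> D * (g n powr (2 + 2 * \<alpha>) * exp (\<sigma>\<^sup>2 / (2 * (g n)\<^sup>2)))"
    if endpoint: "endpoint_exponent \<phi>\<^sub>k \<alpha>"
  proof -
    obtain C where "0 \<le> C"
      "AE s in lborel. \<bar>s\<bar> \<le> 1 \<longrightarrow> cmod (\<phi>\<^sub>k s) \<le> C * (1 - \<bar>s\<bar>) powr \<alpha>"
      using endpoint_envelope[OF endpoint \<open>0 \<le> \<alpha>\<close> \<phi>_bdd hermitian] by blast
    then show ?thesis
      unfolding h_def using deconv_summand_bound[OF \<phi>_meas \<phi>_bdd _ _ \<open>0 \<le> \<alpha>\<close> \<sigma> g_pos] by blast
  qed
  \<comment> \<open>The order \<open>\<delta>\<close> stays free because the two claims use different values of it.\<close>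
  have mse_bound: "\<exists>A B. 0 \<le> A \<and> 0 \<le> B \<and> (\<forall>n>0. mse n \<le> A * v n + B * g n powr (2 + 2 * \<delta>))"
    if endpoint: "endpoint_exponent \<phi>\<^sub>k \<alpha>" and F: "condition_F f \<delta>"
      and C: "\<And>s. s \<noteq> 0 \<Longrightarrow> cmod (\<phi>\<^sub>k s) \<le> C * \<bar>s\<bar> powr \<delta>" for \<delta> C
  proof -
    obtain D where D: "\<And>n x. cmod (h n x) \<le> D * (g n powr (2 + 2 * \<alpha>) * exp (\<sigma>\<^sup>2 / (2 * (g n)\<^sup>2)))"
      using h_bound[OF endpoint] by blast
    define E where "E = C / 2 * (\<integral>t. cmod (complex_of_real (\<bar>t\<bar> powr \<delta>) * fourier f t) \<partial>lborel)"
    have bias: "cmod ((\<integral>x. h n x \<partial>P) - complex_of_real p) \<le> E * g n powr (1 + \<delta>)" for n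
      unfolding h_def E_def
      by (rule deconv_bias_bound[OF P \<phi>_meas \<phi>_bdd assms(20,22) char_P])
         (use p F C g_pos assms(17) in \<open>auto simp: condition_F_def\<close>)
    have "mse n \<le> D\<^sup>2 * v n + E\<^sup>2 * g n powr (2 + 2 * \<delta>)" if "n > 0" for n
    proof -
      have "mse n \<le> (D * (g n powr (2 + 2 * \<alpha>) * exp (\<sigma>\<^sup>2 / (2 * (g n)\<^sup>2))))\<^sup>2 / real n
          + (cmod ((\<integral>x. h n x \<partial>P) - complex_of_real p))\<^sup>2"
        unfolding mse_def p_ng_eq
        by (rule N.mean_square_error_sample_mean[OF assms(15) _ _ D \<open>n > 0\<close>])
           (simp_all add: P_def assms(16))
      also have "\<dots> \<le> (D * (g n powr (2 + 2 * \<alpha>) * exp (\<sigma>\<^sup>2 / (2 * (g n)\<^sup>2))))\<^sup>2 / real n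
          + (E * g n powr (1 + \<delta>))\<^sup>2"
        by (intro add_left_mono power_mono bias) simp
      also have "(D * (g n powr (2 + 2 * \<alpha>) * exp (\<sigma>\<^sup>2 / (2 * (g n)\<^sup>2))))\<^sup>2 / real n = D\<^sup>2 * v n"
      proof -
        have "(g n powr (2 + 2 * \<alpha>))\<^sup>2 = g n powr (4 + 4 * \<alpha>)"
          by (simp add: power2_eq_square flip: powr_add)
        moreover have "(exp (\<sigma>\<^sup>2 / (2 * (g n)\<^sup>2)))\<^sup>2 = exp (\<sigma>\<^sup>2 / (g n)\<^sup>2)"
          by (simp flip: exp_double)
        ultimately show ?thesis by (simp add: v_def power_mult_distrib)
      qed
      also have "(E * g n powr (1 + \<delta>))\<^sup>2 = E\<^sup>2 * g n powr (2 + 2 * \<delta>)"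
        by (simp add: power2_eq_square algebra_simps flip: powr_add)
      finally show ?thesis .
    qed
    then show ?thesis by (intro exI[of _ "D\<^sup>2"] exI[of _ "E\<^sup>2"]) simp
  qed

  \<comment> \<open>Consistency takes \<open>\<delta> = 0\<close>: integrability of \<open>fourier f\<close> and boundedness of \<open>\<phi>\<^sub>k\<close> are the case of exponent zero.\<close>
  have consistent: "(\<lambda>n. measure N {\<omega> \<in> space N.
      cmod (p_ng \<sigma> \<phi>\<^sub>k Xs n (g n) \<omega> - complex_of_real p) > \<epsilon>}) \<longlonglongrightarrow> 0"
    if endpoint: "endpoint_exponent \<phi>\<^sub>k \<alpha>" and v: "v \<longlonglongrightarrow> 0" and "\<epsilon> > 0" for \<epsilon>
  proof -
    \<comment> \<open>The two integrands differ at \<open>u = 0\<close>, where \<open>0 powr 0 = 0\<close>.\<close>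
    have "integrable lborel (\<lambda>u. complex_of_real (\<bar>u\<bar> powr 0) * fourier f u)"
    proof (rule integrable_cong_AE_imp[OF assms(17)])
      show "AE u in lborel. fourier f u = complex_of_real (\<bar>u\<bar> powr 0) * fourier f u"
        using AE_lborel_singleton[of "0::real"] by eventually_elim simp
    qed (use borel_measurable_integrable[OF assms(17)] in measurable)
    then have "condition_F f 0" by (simp add: condition_F_def)
    moreover have "cmod (\<phi>\<^sub>k s) \<le> K * \<bar>s\<bar> powr 0" if "s \<noteq> 0" for s
      using \<phi>_bdd that by simp
    ultimately obtain A B where
      AB: "0 \<le> A" "0 \<le> B" "\<And>n. n > 0 \<Longrightarrow> mse n \<le> A * v n + B * g n powr (2 + 2 * 0)"
      using mse_bound[OF endpoint] by blast
    have markov: "measure N {\<omega> \<in> space N. cmod (p_ng \<sigma> \<phi>\<^sub>k Xs n (g n) \<omega> - complex_of_real p) > \<epsilon>}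
        \<le> mse n / \<epsilon>\<^sup>2" for n
    proof -
      obtain D where D: "\<And>n x. cmod (h n x) \<le> D * (g n powr (2 + 2 * \<alpha>) * exp (\<sigma>\<^sup>2 / (2 * (g n)\<^sup>2)))"
        using h_bound[OF endpoint] by blast
      define b where "b = D * (g n powr (2 + 2 * \<alpha>) * exp (\<sigma>\<^sup>2 / (2 * (g n)\<^sup>2)))"
      define e where "e = (\<lambda>\<omega>. cmod ((\<Sum>j<n. h n (Xs j \<omega>)) / of_nat n - complex_of_real p))"
      have [measurable]: "e \<in> borel_measurable N" unfolding e_def by measurable
      \<comment> \<open>The quotient \<open>real n / real n\<close> is kept so that the bound also covers \<open>n = 0\<close>, where it is \<open>0\<close>.\<close>
      have e_le: "e \<omega> \<le> real n * b / real n + p" for \<omega>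
      proof -
        have "cmod (\<Sum>j<n. h n (Xs j \<omega>)) \<le> real n * b"
          using sum_norm_bound[of "{..<n}" "\<lambda>j. h n (Xs j \<omega>)" b] D by (simp add: b_def)
        then have "cmod ((\<Sum>j<n. h n (Xs j \<omega>)) / of_nat n) \<le> real n * b / real n"
          unfolding norm_divide norm_of_nat by (rule divide_right_mono) simp
        then show ?thesis
          unfolding e_def using p norm_triangle_ineq4[of "(\<Sum>j<n. h n (Xs j \<omega>)) / of_nat n" "complex_of_real p"]
          by simp
      qed
      have "integrable N (\<lambda>\<omega>. (e \<omega>)\<^sup>2)"
      proof (rule N.integrable_const_bound)
        show "AE \<omega> in N. norm ((e \<omega>)\<^sup>2) \<le> (real n * b / real n + p)\<^sup>2"
          using e_le by (auto simp: e_def intro!: power_mono)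
      qed measurable
      then have "measure N {\<omega> \<in> space N. (e \<omega>)\<^sup>2 \<ge> \<epsilon>\<^sup>2} \<le> N.expectation (\<lambda>\<omega>. (e \<omega>)\<^sup>2) / \<epsilon>\<^sup>2"
        using \<open>\<epsilon> > 0\<close> by (intro integral_Markov_inequality_measure[where A = "{}"]) auto
      moreover have "measure N {\<omega> \<in> space N. e \<omega> > \<epsilon>} \<le> measure N {\<omega> \<in> space N. (e \<omega>)\<^sup>2 \<ge> \<epsilon>\<^sup>2}"
        using \<open>\<epsilon> > 0\<close> by (intro N.finite_measure_mono) (auto intro!: power_mono)
      ultimately show ?thesis unfolding mse_def p_ng_eq e_def by simp
    qed
    have "(\<lambda>n. (A * v n + B * (g n)\<^sup>2) / \<epsilon>\<^sup>2) \<longlonglongrightarrow> (A * 0 + B * 0\<^sup>2) / \<epsilon>\<^sup>2"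
      by (intro tendsto_intros v \<open>g \<longlonglongrightarrow> 0\<close>) (use \<open>\<epsilon> > 0\<close> in simp)
    then have lim: "(\<lambda>n. (A * v n + B * (g n)\<^sup>2) / \<epsilon>\<^sup>2) \<longlonglongrightarrow> 0" by simp
    show ?thesis
    proof (rule tendsto_sandwich[OF _ _ tendsto_const lim])
      show "\<forall>\<^sub>F n in sequentially. measure N {\<omega> \<in> space N.
          cmod (p_ng \<sigma> \<phi>\<^sub>k Xs n (g n) \<omega> - complex_of_real p) > \<epsilon>} \<le> (A * v n + B * (g n)\<^sup>2) / \<epsilon>\<^sup>2"
        using eventually_gt_at_top[of 0]
      proof eventually_elim
        case (elim n)
        have "mse n \<le> A * v n + B * (g n)\<^sup>2" using AB(3)[OF elim] g_pos[of n] by simp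
        then show ?case using markov[of n] by (meson divide_right_mono order_trans zero_le_power2)
      qed
    qed simp
  qed
  moreover have "mse \<in> O(\<lambda>n. g n powr (2 + 2 * \<gamma>) + v n)"
    if F: "condition_F f \<gamma>" and kernel: "condition_K \<phi>\<^sub>k \<alpha> \<gamma>"
  proof -
    obtain C where "\<And>s. s \<noteq> 0 \<Longrightarrow> cmod (\<phi>\<^sub>k s) \<le> C * \<bar>s\<bar> powr \<gamma>"
      using condition_K_origin_bound[OF kernel \<phi>_bdd] \<open>\<gamma> > 0\<close> by (metis less_imp_le)
    then obtain A B where
      AB: "0 \<le> A" "0 \<le> B" "\<And>n. n > 0 \<Longrightarrow> mse n \<le> A * v n + B * g n powr (2 + 2 * \<gamma>)"
      using mse_bound[OF condition_K_endpoint_exponent[OF kernel] F] by blast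
    show ?thesis
    proof (rule bigoI[where c = "A + B"])
      show "\<forall>\<^sub>F n in sequentially. norm (mse n) \<le> (A + B) * norm (g n powr (2 + 2 * \<gamma>) + v n)"
        using eventually_gt_at_top[of 0]
      proof eventually_elim
        case (elim n)
        have v: "0 \<le> v n" by (simp add: v_def)
        have "norm (mse n) = mse n" by (simp add: mse_def)
        also have "\<dots> \<le> A * v n + B * g n powr (2 + 2 * \<gamma>)" by (rule AB(3)[OF elim])
        also have "\<dots> \<le> (A + B) * (g n powr (2 + 2 * \<gamma>) + v n)"
          using AB(1,2) v by (simp add: algebra_simps)
        finally show ?case using v by simp
      qed
    qed
  qed
  ultimately show ?thesis by (simp add: mse_def v_def[abs_def])
qed

end
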